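(* Let $g=1+\sum_{|\alpha|\ge1}b_\alpha Z_\alpha$ be a free holomorphic function in a neighborhood of the origin with $b_\alpha>0$ if $|\alpha|\ge1$, and such that $$\sup_{\alpha\in\mathbb F_n^+}\frac{b_\alpha}{b_{g_i\alpha}}<\infty\quad\text{and}\quad\sup_{\alpha\in\mathbb F_n^+}\frac{b_\alpha}{b_{\alpha g_i}}<\infty,\qquad i\in\{1,\ldots,n\},$$ and let ${\bf W}=(W_1,\ldots,W_n)$ be the associated weighted left creation operators. Then the noncommutative Hardy algebra $F^\infty(g)$ satisfies $$F^\infty(g)=\overline{\mathcal P({\bf W})}^{SOT}=\overline{\mathcal P({\bf W})}^{WOT}=\overline{\mathcal P({\bf W})}^{w*},$$ where $\mathcal P({\bf W})$ is the algebra of all polynomials in $W_1,\ldots,W_n$ and the identity. Moreover, $F^\infty(g)$ is the sequential SOT- (resp. WOT-, w*-) closure of $\mathcal P({\bf W})$.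
   Context: $\mathbb F_n^+$ is the unital free semigroup on generators $g_1,\ldots,g_n$ with identity $g_0$; $|\alpha|$ is the length of $\alpha$; $b_{g_0}=1$. For $\alpha=g_{i_1}\cdots g_{i_k}$, $X_\alpha:=X_{i_1}\cdots X_{i_k}$, $X_{g_0}:=I$. $F^2(H_n)$ is the full Fock space with orthonormal basis $\{e_\alpha\}_{\alpha\in\mathbb F_n^+}$, $e_\alpha=e_{i_1}\otimes\cdots\otimes e_{i_k}$, $e_{g_0}=1$. A formal power series $\sum_\alpha c_\alpha Z_\alpha$ in noncommuting indeterminates is a free holomorphic function in a neighborhood of the origin if there is $\rho>0$ such that $\sum_{k}\sum_{|\alpha|=k}c_\alpha X_\alpha$ converges in norm for every Hilbert space $\mathcal H$ and every $X\in B(\mathcal H)^n$ with $\|\sum_iX_iX_i^*\|^{1/2}\le\rho$; equivalently $\limsup_k(\sum_{|\alpha|=k}|c_\alpha|^2)^{1/2k}<\infty$. The weighted left creation operators are $W_ie_\alpha=\sqrt{b_\alpha/b_{g_i\alpha}}\,e_{g_i\alpha}$. Definition of $F^\infty(g)$: let $\mathcal P$ be the linear span of $\{e_\alpha\}$. Consider formal series $\sum_{\beta}c_\beta W_\beta$, $c_\beta\in\mathbb C$, such that $\sum_{\beta}|c_\beta|^2\frac{b_\gamma}{b_{\beta\gamma}}<\infty$ for each $\gamma\in\mathbb F_n^+$ and $\sup_{p\in\mathcal P,\|p\|\le1}\|\sum_\beta c_\beta W_\beta(p)\|<\infty$. Each such series determines a unique bounded operator $\varphi({\bf W})$ on $F^2(H_n)$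 with $\varphi({\bf W})p=\sum_\beta c_\beta W_\beta(p)$ for $p\in\mathcal P$; $F^\infty(g)$ is the set of all such operators. *)

theory Defs
  imports "HOL-Analysis.Analysis"
begin

section \<open>The complex Hilbert space of square-summable families\<close>

typedef 'i ell2 = "{x :: 'i \<Rightarrow> complex. (\<lambda>i. (cmod (x i))\<^sup>2) summable_on UNIV}"
  morphisms coord Abs_ell2
  by (intro exI[of _ "\<lambda>_. 0"]) simp

setup_lifting type_definition_ell2

lemma coord_summable: "(\<lambda>i. (cmod (coord x i))\<^sup>2) summable_on UNIV"
  using coord by blast

lemma ell2_eqI: "(\<And>i. coord x i = coord y i) \<Longrightarrow> x = y"
  by (metis coord_inject ext)

lemma square_summable_prod:
  fixes x y :: "'i \<Rightarrow> complex"
  assumes "(\<lambda>i. (cmod (x i))\<^sup>2) summable_on A" "(\<lambda>i. (cmod (y i))\<^sup>2) summable_on A"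
  shows "(\<lambda>i. cmod (x i * y i)) summable_on A"
  by (rule abs_summable_product) (use assms in \<open>simp_all add: norm_mult power2_eq_square\<close>)

lemma square_summable_add:
  fixes x y :: "'i \<Rightarrow> complex"
  assumes "(\<lambda>i. (cmod (x i))\<^sup>2) summable_on A" "(\<lambda>i. (cmod (y i))\<^sup>2) summable_on A"
  shows "(\<lambda>i. (cmod (x i + y i))\<^sup>2) summable_on A"
proof (rule summable_on_comparison_test)
  show "(\<lambda>i. 2 * (cmod (x i))\<^sup>2 + 2 * (cmod (y i))\<^sup>2) summable_on A"
    by (intro summable_on_add summable_on_cmult_right assms)
  fix i
  have "(cmod (x i + y i))\<^sup>2 \<le> (cmod (x i) + cmod (y i))\<^sup>2"
    by (simp add: norm_triangle_ineq power_mono)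
  also have "\<dots> \<le> 2 * (cmod (x i))\<^sup>2 + 2 * (cmod (y i))\<^sup>2"
    using sum_squares_bound[of "cmod (x i)" "cmod (y i)"] by (simp add: power2_sum)
  finally show "(cmod (x i + y i))\<^sup>2 \<le> 2 * (cmod (x i))\<^sup>2 + 2 * (cmod (y i))\<^sup>2" .
qed auto

lemma square_summable_scale:
  fixes x :: "'i \<Rightarrow> complex"
  assumes "(\<lambda>i. (cmod (x i))\<^sup>2) summable_on A"
  shows "(\<lambda>i. (cmod (c * x i))\<^sup>2) summable_on A"
  using summable_on_cmult_right[OF assms, of "(cmod c)\<^sup>2"] by (simp add: norm_mult power_mult_distrib)

lift_definition cscale :: "complex \<Rightarrow> 'i ell2 \<Rightarrow> 'i ell2"  (infixr "*\<^sub>C" 75)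
  is "\<lambda>c x i. c * x i"
  by (rule square_summable_scale)

lift_definition basis_vec :: "'i \<Rightarrow> 'i ell2"
  is "\<lambda>i j. if j = i then 1 else 0"
proof -
  fix i :: 'i
  have "(\<lambda>j. (cmod (if j = i then 1 else 0))\<^sup>2) summable_on UNIV \<longleftrightarrow>
        (\<lambda>j. (cmod (if j = i then 1 else 0))\<^sup>2) summable_on {i}"
    by (rule summable_on_cong_neutral) auto
  then show "(\<lambda>j. (cmod (if j = i then 1 else 0))\<^sup>2) summable_on UNIV" by simp
qed

text \<open>The complex inner product is linear in the first argument.\<close>

definition cinner :: "'i ell2 \<Rightarrow> 'i ell2 \<Rightarrow> complex" where
  "cinner x y = (\<Sum>\<^sub>\<infinity>i. coord x i * cnj (coord y i))"

lemma cinner_summable: "(\<lambda>i. cmod (coord x i * cnj (coord y i))) summable_on UNIV"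
  by (rule square_summable_prod) (use coord_summable in auto)

lemma cinner_summable': "(\<lambda>i. coord x i * cnj (coord y i)) summable_on UNIV"
  using cinner_summable by (rule abs_summable_summable)

instantiation ell2 :: (type) real_vector
begin
lift_definition zero_ell2 :: "'i ell2" is "\<lambda>_. 0" by simp
lift_definition plus_ell2 :: "'i ell2 \<Rightarrow> 'i ell2 \<Rightarrow> 'i ell2" is "\<lambda>x y i. x i + y i"
  by (rule square_summable_add)
lift_definition uminus_ell2 :: "'i ell2 \<Rightarrow> 'i ell2" is "\<lambda>x i. - x i" by simp
lift_definition minus_ell2 :: "'i ell2 \<Rightarrow> 'i ell2 \<Rightarrow> 'i ell2" is "\<lambda>x y i. x i - y i"
proof -
  fix x y :: "'i \<Rightarrow> complex"
  assume "(\<lambda>i. (cmod (x i))\<^sup>2) summable_on UNIV" "(\<lambda>i. (cmod (y i))\<^sup>2) summable_on UNIV"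
  then show "(\<lambda>i. (cmod (x i - y i))\<^sup>2) summable_on UNIV"
    using square_summable_add[of x UNIV "\<lambda>i. - y i"] by simp
qed
lift_definition scaleR_ell2 :: "real \<Rightarrow> 'i ell2 \<Rightarrow> 'i ell2" is "\<lambda>r x i. of_real r * x i"
  by (rule square_summable_scale)
instance
  by (standard; transfer) (auto simp: algebra_simps)
end

lemma coord_simps [simp]:
  "coord 0 i = 0" "coord (x + y) i = coord x i + coord y i"
  "coord (x - y) i = coord x i - coord y i" "coord (- x) i = - coord x i"
  "coord (r *\<^sub>R x) i = of_real r * coord x i" "coord (c *\<^sub>C x) i = c * coord x i"
  "coord (basis_vec j) i = (if i = j then 1 else 0)"
  by (transfer; simp)+

lemma coord_sum [simp]: "coord (sum f A) i = (\<Sum>a\<in>A. coord (f a) i)"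
  by (induction A rule: infinite_finite_induct) auto

lemma cinner_add_left: "cinner (x + y) z = cinner x z + cinner y z"
  unfolding cinner_def
  by (subst infsum_add[symmetric]) (auto simp: cinner_summable' algebra_simps)

lemma cinner_cscale_left: "cinner (c *\<^sub>C x) z = c * cinner x z"
  unfolding cinner_def
  by (subst infsum_cmult_right[symmetric]) (auto simp: cinner_summable' algebra_simps)

lemma cinner_commute: "cinner x y = cnj (cinner y x)"
  unfolding cinner_def by (subst infsum_cnj[symmetric]) (simp add: mult.commute)

lemma scaleR_cscale: "r *\<^sub>R x = complex_of_real r *\<^sub>C (x :: 'i ell2)"
  by (rule ell2_eqI) simp

lemma cinner_self: "cinner x x = of_real (\<Sum>\<^sub>\<infinity>i. (cmod (coord x i))\<^sup>2)"
proof -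
  have "((\<lambda>i. complex_of_real ((cmod (coord x i))\<^sup>2)) has_sum
          of_real (\<Sum>\<^sub>\<infinity>i. (cmod (coord x i))\<^sup>2)) UNIV"
    by (rule has_sum_bounded_linear[OF bounded_linear_of_real])
       (simp add: coord_summable)
  moreover have "complex_of_real ((cmod z)\<^sup>2) = z * cnj z" for z
    by (rule complex_norm_square)
  ultimately show ?thesis unfolding cinner_def by (simp add: infsumI)
qed

instantiation ell2 :: (type) real_inner
begin
definition inner_ell2 :: "'i ell2 \<Rightarrow> 'i ell2 \<Rightarrow> real" where "inner_ell2 x y = Re (cinner x y)"
definition norm_ell2 :: "'i ell2 \<Rightarrow> real" where "norm_ell2 x = sqrt (inner x x)"
definition sgn_ell2 :: "'i ell2 \<Rightarrow> 'i ell2" where "sgn_ell2 x = x /\<^sub>R norm x"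
definition dist_ell2 :: "'i ell2 \<Rightarrow> 'i ell2 \<Rightarrow> real" where "dist_ell2 x y = norm (x - y)"
definition uniformity_ell2 :: "('i ell2 \<times> 'i ell2) filter" where
  "uniformity_ell2 = (INF e\<in>{0<..}. principal {(x, y). dist x y < e})"
definition open_ell2 :: "'i ell2 set \<Rightarrow> bool" where
  "open_ell2 U \<longleftrightarrow> (\<forall>x\<in>U. \<forall>\<^sub>F (x', y) in uniformity. x' = x \<longrightarrow> y \<in> U)"
instance
proof
  fix x y z :: "'i ell2" and r :: real
  show "inner x y = inner y x"
    unfolding inner_ell2_def by (subst cinner_commute) simp
  show "inner (x + y) z = inner x z + inner y z"
    by (simp add: inner_ell2_def cinner_add_left)
  show "inner (r *\<^sub>R x) y = r * inner x y"
    by (simp add: inner_ell2_def scaleR_cscale cinner_cscale_left)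
  show "0 \<le> inner x x"
    by (simp add: inner_ell2_def cinner_self infsum_nonneg)
  show "inner x x = 0 \<longleftrightarrow> x = 0"
  proof
    assume "inner x x = 0"
    then have "(\<Sum>\<^sub>\<infinity>i. (cmod (coord x i))\<^sup>2) = 0" by (simp add: inner_ell2_def cinner_self)
    then have "(cmod (coord x i))\<^sup>2 = 0" for i
      using nonneg_infsum_le_0D[of "\<lambda>i. (cmod (coord x i))\<^sup>2" UNIV i] coord_summable by force
    then show "x = 0" by (intro ell2_eqI) simp
  next
    assume "x = 0"
    then show "inner x x = 0" by (simp add: inner_ell2_def cinner_def)
  qed
qed (simp_all add: norm_ell2_def sgn_ell2_def dist_ell2_def uniformity_ell2_def open_ell2_def)
end

lemma norm_ell2_square: "(norm x)\<^sup>2 = (\<Sum>\<^sub>\<infinity>i. (cmod (coord x i))\<^sup>2)"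
  by (simp add: norm_ell2_def inner_ell2_def cinner_self infsum_nonneg)

lemma sum_coord_le_norm:
  assumes "finite F"
  shows "(\<Sum>i\<in>F. (cmod (coord x i))\<^sup>2) \<le> (norm x)\<^sup>2"
  unfolding norm_ell2_square
  by (rule finite_sum_le_infsum) (use assms coord_summable in auto)

lemma coord_le_norm: "cmod (coord x i) \<le> norm x"
  using sum_coord_le_norm[of "{i}" x] by (simp add: power2_le_iff_abs_le)

lemma norm_ell2_leI:
  assumes "B \<ge> 0" "\<And>F. finite F \<Longrightarrow> (\<Sum>i\<in>F. (cmod (coord x i))\<^sup>2) \<le> B\<^sup>2"
  shows "norm x \<le> B"
proof -
  have "(norm x)\<^sup>2 \<le> B\<^sup>2"
    unfolding norm_ell2_square by (rule infsum_le_finite_sums[OF coord_summable]) (use assms in auto)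
  then show ?thesis using assms(1) by (simp add: power2_le_iff_abs_le)
qed

lemma norm_cscale [simp]: "norm (c *\<^sub>C x) = cmod c * norm x"
proof -
  have "(norm (c *\<^sub>C x))\<^sup>2 = (cmod c * norm x)\<^sup>2"
    unfolding power_mult_distrib norm_ell2_square
    by (subst infsum_cmult_right[symmetric]) (auto simp: coord_summable norm_mult power_mult_distrib)
  then show ?thesis by (simp add: power2_eq_iff_nonneg)
qed

lemma cscale_simps [simp]:
  "c *\<^sub>C (x + y) = c *\<^sub>C x + c *\<^sub>C y" "(c + d) *\<^sub>C x = c *\<^sub>C x + d *\<^sub>C x"
  "c *\<^sub>C (d *\<^sub>C x) = (c * d) *\<^sub>C x" "c *\<^sub>C (r *\<^sub>R x) = r *\<^sub>R (c *\<^sub>C x)"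
  "1 *\<^sub>C x = x" "0 *\<^sub>C x = 0" "c *\<^sub>C 0 = 0"
  by (auto intro!: ell2_eqI simp: algebra_simps)

lemma bounded_linear_cscale: "bounded_linear (cscale c)"
  by (rule bounded_linear_intro[of _ "cmod c"]) auto

instance ell2 :: (type) complete_space
proof
  fix X :: "nat \<Rightarrow> 'i ell2"
  assume X: "Cauchy X"
  have "Cauchy (\<lambda>n. coord (X n) i)" for i
  proof (rule CauchyI)
    fix e :: real assume "e > 0"
    then obtain M where "\<forall>m\<ge>M. \<forall>n\<ge>M. norm (X m - X n) < e" using CauchyD[OF X] by blast
    then show "\<exists>M. \<forall>m\<ge>M. \<forall>n\<ge>M. norm (coord (X m) i - coord (X n) i) < e"
      by (metis coord_le_norm coord_simps(3) le_less_trans)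
  qed
  then have l: "(\<lambda>n. coord (X n) i) \<longlonglongrightarrow> lim (\<lambda>n. coord (X n) i)" for i
    by (simp add: Cauchy_convergent_iff convergent_LIMSEQ_iff)
  define l where "l i = lim (\<lambda>n. coord (X n) i)" for i
  note l = l[folded l_def]
  have key: "\<exists>M. \<forall>n\<ge>M. \<forall>F. finite F \<longrightarrow> (\<Sum>i\<in>F. (cmod (l i - coord (X n) i))\<^sup>2) \<le> e\<^sup>2"
    if e: "e > 0" for e :: real
  proof -
    obtain M where M: "\<And>m n. m \<ge> M \<Longrightarrow> n \<ge> M \<Longrightarrow> norm (X m - X n) < e"
      using CauchyD[OF X e] by blast
    have "(\<Sum>i\<in>F. (cmod (l i - coord (X n) i))\<^sup>2) \<le> e\<^sup>2" if n: "n \<ge> M" and F: "finite F" for n F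
    proof (rule LIMSEQ_le_const2)
      show "(\<lambda>m. \<Sum>i\<in>F. (cmod (coord (X m) i - coord (X n) i))\<^sup>2) \<longlonglongrightarrow>
            (\<Sum>i\<in>F. (cmod (l i - coord (X n) i))\<^sup>2)"
        by (intro tendsto_intros l)
      have "(\<Sum>i\<in>F. (cmod (coord (X m) i - coord (X n) i))\<^sup>2) \<le> e\<^sup>2" if "m \<ge> M" for m
      proof -
        have "(\<Sum>i\<in>F. (cmod (coord (X m) i - coord (X n) i))\<^sup>2) \<le> (norm (X m - X n))\<^sup>2"
          using sum_coord_le_norm[OF F, of "X m - X n"] by simp
        also have "\<dots> \<le> e\<^sup>2" using M[OF that n] by (intro power_mono) auto
        finally show ?thesis .
      qed
      then show "\<exists>N. \<forall>m\<ge>N. (\<Sum>i\<in>F. (cmod (coord (X m) i - coord (X n) i))\<^sup>2) \<le> e\<^sup>2" by blast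
    qed
    then show ?thesis by blast
  qed
  obtain M where M: "\<And>n F. n \<ge> M \<Longrightarrow> finite F \<Longrightarrow> (\<Sum>i\<in>F. (cmod (l i - coord (X n) i))\<^sup>2) \<le> 1\<^sup>2"
    using key[of 1] by auto
  have "(\<lambda>i. (cmod (l i - coord (X M) i))\<^sup>2) summable_on UNIV"
    by (rule nonneg_bdd_above_summable_on) (use M[of M] in \<open>auto intro!: bdd_aboveI2[of _ _ 1]\<close>)
  from square_summable_add[OF this coord_summable[of "X M"]]
  have lsum: "(\<lambda>i. (cmod (l i))\<^sup>2) summable_on UNIV" by simp
  define L where "L = Abs_ell2 l"
  have L: "coord L i = l i" for i using lsum by (simp add: L_def Abs_ell2_inverse)
  have "X \<longlonglongrightarrow> L"
  proof (rule LIMSEQ_I)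
    fix e :: real assume e: "e > 0"
    obtain M where M: "\<And>n F. n \<ge> M \<Longrightarrow> finite F \<Longrightarrow> (\<Sum>i\<in>F. (cmod (l i - coord (X n) i))\<^sup>2) \<le> (e/2)\<^sup>2"
      using key[of "e/2"] e by auto
    have "norm (X n - L) < e" if "n \<ge> M" for n
    proof -
      have "norm (L - X n) \<le> e/2"
        by (rule norm_ell2_leI) (use e M[OF that] L in auto)
      then show ?thesis using e by (simp add: norm_minus_commute)
    qed
    then show "\<exists>N. \<forall>n\<ge>N. norm (X n - L) < e" by blast
  qed
  then show "convergent X" by (auto simp: convergent_def)
qed

instance ell2 :: (type) banach ..

lemma ell2_expansion: "((\<lambda>i. coord x i *\<^sub>C basis_vec i) has_sum x) UNIV"
  unfolding has_sum_def tendsto_iff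
proof (intro allI impI)
  fix e :: real assume e: "e > 0"
  have "((\<lambda>i. (cmod (coord x i))\<^sup>2) has_sum (norm x)\<^sup>2) UNIV"
    unfolding norm_ell2_square by (simp add: coord_summable)
  then have "\<forall>\<^sub>F F in finite_subsets_at_top UNIV. dist (\<Sum>i\<in>F. (cmod (coord x i))\<^sup>2) ((norm x)\<^sup>2) < e\<^sup>2"
    unfolding has_sum_def tendsto_iff using e by simp
  moreover have "\<forall>\<^sub>F F in finite_subsets_at_top (UNIV::'a set). finite F"
    by (auto simp: eventually_finite_subsets_at_top)
  ultimately show "\<forall>\<^sub>F F in finite_subsets_at_top UNIV. dist (\<Sum>i\<in>F. coord x i *\<^sub>C basis_vec i) x < e"
  proof eventually_elim
    case (elim F)
    let ?d = "x - (\<Sum>i\<in>F. coord x i *\<^sub>C basis_vec i)"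
    have d: "coord ?d i = (if i \<in> F then 0 else coord x i)" for i
      using elim(2) by (simp add: if_distrib[of "\<lambda>t. _ * t"] sum.delta cong: if_cong)
    have "(norm ?d)\<^sup>2 \<le> (norm x)\<^sup>2 - (\<Sum>i\<in>F. (cmod (coord x i))\<^sup>2)"
      unfolding norm_ell2_square[of ?d]
    proof (rule infsum_le_finite_sums[OF coord_summable])
      fix G :: "'a set" assume G: "finite G"
      have "(\<Sum>i\<in>G. (cmod (coord ?d i))\<^sup>2) = (\<Sum>i\<in>G - F. (cmod (coord x i))\<^sup>2)"
        unfolding d by (rule sum.mono_neutral_cong_right) (use G in auto)
      moreover have "(\<Sum>i\<in>(G - F) \<union> F. (cmod (coord x i))\<^sup>2) \<le> (norm x)\<^sup>2"
        by (rule sum_coord_le_norm) (use G elim in auto)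
      moreover have "(\<Sum>i\<in>(G - F) \<union> F. (cmod (coord x i))\<^sup>2) =
          (\<Sum>i\<in>G - F. (cmod (coord x i))\<^sup>2) + (\<Sum>i\<in>F. (cmod (coord x i))\<^sup>2)"
        by (rule sum.union_disjoint) (use G elim in auto)
      ultimately show "(\<Sum>i\<in>G. (cmod (coord ?d i))\<^sup>2) \<le> (norm x)\<^sup>2 - (\<Sum>i\<in>F. (cmod (coord x i))\<^sup>2)"
        by linarith
    qed
    also have "\<dots> < e\<^sup>2" using elim(1) by (simp add: dist_real_def)
    finally have "norm ?d < e" using e by (simp add: power2_less_imp_less)
    then show ?case by (simp add: dist_norm norm_minus_commute)
  qed
qed


lemma cinner_cscale_right: "cinner x (c *\<^sub>C y) = cnj c * cinner x y"
  by (metis cinner_commute cinner_cscale_left complex_cnj_mult)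

lemma cinner_Cauchy_Schwarz: "cmod (cinner x y) \<le> norm x * norm y"
proof -
  define c where "c = cnj (sgn (cinner x y))"
  have "c * cinner x y = of_real (cmod (cinner x y))"
    unfolding c_def sgn_eq
    by (simp add: divide_simps complex_norm_square[symmetric] power2_eq_square mult.commute[of "cnj _"])
  then have "cmod (cinner x y) = inner (c *\<^sub>C x) y"
    by (simp add: inner_ell2_def cinner_cscale_left)
  also have "\<dots> \<le> norm (c *\<^sub>C x) * norm y" by (rule norm_cauchy_schwarz)
  also have "norm (c *\<^sub>C x) \<le> norm x"
    by (auto simp: c_def norm_sgn)
  finally show ?thesis by (simp add: mult_right_mono)
qed

lemma norm_basis_sum:
  assumes "finite F"
  shows "(norm (\<Sum>i\<in>F. u i *\<^sub>C basis_vec i))\<^sup>2 = (\<Sum>i\<in>F. (cmod (u i))\<^sup>2)"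
proof -
  have "coord (\<Sum>i\<in>F. u i *\<^sub>C basis_vec i) j = (if j \<in> F then u j else 0)" for j
    using assms by (simp add: if_distrib[of "\<lambda>t. _ * t"] sum.delta cong: if_cong)
  then have "(norm (\<Sum>i\<in>F. u i *\<^sub>C basis_vec i))\<^sup>2 = (\<Sum>\<^sub>\<infinity>j. (cmod (if j \<in> F then u j else 0))\<^sup>2)"
    unfolding norm_ell2_square by simp
  also have "\<dots> = (\<Sum>\<^sub>\<infinity>j\<in>F. (cmod (u j))\<^sup>2)"
    by (rule infsum_cong_neutral) auto
  finally show ?thesis using assms by simp
qed


section \<open>Bounded operators\<close>

text \<open>The library's bounded linear maps are real-linear; the algebra of bounded operators on the
  complex Hilbert space consists of the complex-linear ones.\<close>

type_synonym 'i ell2_op = "'i ell2 \<Rightarrow>\<^sub>L 'i ell2"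

definition bounded_ops :: "'i ell2_op set" where
  "bounded_ops = {T. \<forall>c x. blinfun_apply T (c *\<^sub>C x) = c *\<^sub>C blinfun_apply T x}"

definition op_scale :: "complex \<Rightarrow> 'i ell2_op \<Rightarrow> 'i ell2_op" where
  "op_scale c T = Blinfun (cscale c) o\<^sub>L T"

lemma op_scale_apply [simp]: "blinfun_apply (op_scale c T) x = c *\<^sub>C blinfun_apply T x"
  by (simp add: op_scale_def bounded_linear_Blinfun_apply bounded_linear_cscale)

fun op_word :: "('n \<Rightarrow> 'i ell2_op) \<Rightarrow> 'n list \<Rightarrow> 'i ell2_op" where
  "op_word X [] = id_blinfun"
| "op_word X (i # \<alpha>) = X i o\<^sub>L op_word X \<alpha>"

lemma bounded_opsD: "T \<in> bounded_ops \<Longrightarrow> blinfun_apply T (c *\<^sub>C x) = c *\<^sub>C blinfun_apply T x"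
  by (simp add: bounded_ops_def)

lemma has_sum_op_basis:
  assumes "T \<in> bounded_ops"
  shows "((\<lambda>i. coord x i *\<^sub>C blinfun_apply T (basis_vec i)) has_sum blinfun_apply T x) UNIV"
  using has_sum_bounded_linear[OF blinfun.bounded_linear_right ell2_expansion, of T x]
  by (simp add: bounded_opsD[OF assms])

lemma bounded_ops_eqI:
  assumes "S \<in> bounded_ops" "T \<in> bounded_ops"
    and "\<And>i. blinfun_apply S (basis_vec i) = blinfun_apply T (basis_vec i)"
  shows "S = T"
  by (metis (mono_tags, lifting) assms blinfun_eqI has_sum_cong has_sum_op_basis has_sum_unique)

text \<open>On complex-linear operators, the library's adjoint with respect to the real inner product
  \<open>Re (cinner x y)\<close> is the usual Hilbert space adjoint.\<close>

lemma adjoint_op: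
  assumes T: "T \<in> bounded_ops"
  shows "inner (blinfun_apply T x) y = inner x (adjoint (blinfun_apply T) y)"
proof -
  have "\<exists>w. \<forall>x. inner (blinfun_apply T x) y = inner x w" for y
  proof -
    define u where "u i = cinner y (blinfun_apply T (basis_vec i))" for i
    define K where "K = norm y * norm T"
    have bound: "(\<Sum>i\<in>F. (cmod (u i))\<^sup>2) \<le> K\<^sup>2" if F: "finite F" for F
    proof -
      define s where "s = (\<Sum>i\<in>F. (cmod (u i))\<^sup>2)"
      define z where "z = (\<Sum>i\<in>F. u i *\<^sub>C basis_vec i)"
      have s0: "s \<ge> 0" by (simp add: s_def sum_nonneg)
      have "inner y (blinfun_apply T z) = (\<Sum>i\<in>F. Re (cnj (u i) * u i))"
        by (simp add: z_def blinfun.sum_right inner_sum_right bounded_opsD[OF T])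
           (simp add: inner_ell2_def cinner_cscale_right u_def)
      also have "\<dots> = s"
        unfolding s_def by (intro sum.cong refl) (simp add: cmod_power2 flip: power2_eq_square)
      finally have "s = inner y (blinfun_apply T z)" by simp
      also have "\<dots> \<le> norm y * norm (blinfun_apply T z)" by (rule norm_cauchy_schwarz)
      also have "\<dots> \<le> norm y * (norm T * norm z)" by (intro mult_left_mono norm_blinfun) auto
      also have "norm z = sqrt s"
        using norm_basis_sum[OF F, of u] by (metis norm_ge_zero real_sqrt_unique s_def z_def)
      finally have "s \<le> K * sqrt s" by (simp add: K_def)
      then have "sqrt s * sqrt s \<le> K * sqrt s" using s0 by simp
      then have "sqrt s \<le> K"
        using s0 mult_right_le_imp_le[of "sqrt s" "sqrt s" K]
        by (cases "s = 0") (auto simp: K_def)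
      then have "s \<le> K\<^sup>2" using s0 by (simp add: real_le_lsqrt sqrt_le_D)
      then show ?thesis by (simp add: s_def)
    qed
    have "(\<lambda>i. (cmod (u i))\<^sup>2) summable_on UNIV"
      by (rule nonneg_bdd_above_summable_on) (auto intro!: bdd_aboveI2[of _ _ "K\<^sup>2"] bound)
    then have w: "coord (Abs_ell2 u) i = u i" for i by (simp add: Abs_ell2_inverse)
    have "inner (blinfun_apply T x) y = inner x (Abs_ell2 u)" for x
    proof -
      have "((\<lambda>i. inner (coord x i *\<^sub>C blinfun_apply T (basis_vec i)) y) has_sum inner (blinfun_apply T x) y) UNIV"
        by (rule has_sum_bounded_linear[OF bounded_linear_inner_left has_sum_op_basis[OF T]])
      moreover have "((\<lambda>i. Re (coord x i * cnj (coord (Abs_ell2 u) i))) has_sum inner x (Abs_ell2 u)) UNIV"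
        unfolding inner_ell2_def cinner_def
        by (intro has_sum_Re has_sum_infsum cinner_summable')
      moreover have "inner (coord x i *\<^sub>C blinfun_apply T (basis_vec i)) y
          = Re (coord x i * cnj (coord (Abs_ell2 u) i))" for i
        unfolding inner_ell2_def cinner_cscale_left w u_def by (subst cinner_commute) (rule refl)
      ultimately show ?thesis by (simp add: has_sum_unique)
    qed
    then show ?thesis by blast
  qed
  then have "\<exists>f'. \<forall>x y. inner (blinfun_apply T x) y = inner x (f' y)" by metis
  then show ?thesis unfolding adjoint_def by (rule someI2_ex) blast
qed

lemma weighted_shift:
  fixes h :: "'i \<Rightarrow> 'i"
  assumes inj: "inj_on h A" and w: "\<And>i. i \<in> A \<Longrightarrow> cmod (w i) \<le> K"
  obtains T where "T \<in> bounded_ops"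
    and "\<And>i. blinfun_apply T (basis_vec i) = (if i \<in> A then w i *\<^sub>C basis_vec (h i) else 0)"
    and "\<And>x j. coord (blinfun_apply T x) j =
          (if j \<in> h ` A then w (the_inv_into A h j) * coord x (the_inv_into A h j) else 0)"
    and "\<And>x. norm (blinfun_apply T x) \<le> \<bar>K\<bar> * norm x"
proof -
  define g where "g = the_inv_into A h"
  define f where "f x j = (if j \<in> h ` A then w (g j) * coord x (g j) else 0)" for x j
  have g: "g (h i) = i" if "i \<in> A" for i unfolding g_def by (rule the_inv_into_f_f[OF inj that])
  have bound: "(\<Sum>j\<in>F. (cmod (f x j))\<^sup>2) \<le> (\<bar>K\<bar> * norm x)\<^sup>2" if F: "finite F" for F x
  proof -
    have "(\<Sum>j\<in>F. (cmod (f x j))\<^sup>2) = (\<Sum>j\<in>F \<inter> h ` A. (cmod (w (g j) * coord x (g j)))\<^sup>2)"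
      by (rule sum.mono_neutral_cong_right) (use F in \<open>auto simp: f_def\<close>)
    also have "\<dots> \<le> (\<Sum>j\<in>F \<inter> h ` A. \<bar>K\<bar>\<^sup>2 * (cmod (coord x (g j)))\<^sup>2)"
    proof (rule sum_mono)
      fix j assume "j \<in> F \<inter> h ` A"
      then have "cmod (w (g j)) \<le> \<bar>K\<bar>" using g w by force
      then show "(cmod (w (g j) * coord x (g j)))\<^sup>2 \<le> \<bar>K\<bar>\<^sup>2 * (cmod (coord x (g j)))\<^sup>2"
        unfolding norm_mult power_mult_distrib by (intro mult_right_mono power_mono) auto
    qed
    also have "\<dots> = \<bar>K\<bar>\<^sup>2 * (\<Sum>i\<in>g ` (F \<inter> h ` A). (cmod (coord x i))\<^sup>2)"
      by (subst sum.reindex) (auto simp: inj_on_def g sum_distrib_left)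
    also have "\<dots> \<le> \<bar>K\<bar>\<^sup>2 * (norm x)\<^sup>2"
      by (intro mult_left_mono sum_coord_le_norm) (use F in auto)
    finally show ?thesis by (simp only: power_mult_distrib)
  qed
  have "(\<lambda>j. (cmod (f x j))\<^sup>2) summable_on UNIV" for x
    by (rule nonneg_bdd_above_summable_on) (auto intro!: bdd_aboveI2 bound)
  then have co: "coord (Abs_ell2 (f x)) j = f x j" for x j by (simp add: Abs_ell2_inverse)
  have nb: "norm (Abs_ell2 (f x)) \<le> \<bar>K\<bar> * norm x" for x
    by (rule norm_ell2_leI) (use bound in \<open>auto simp: co\<close>)
  have "bounded_linear (\<lambda>x. Abs_ell2 (f x))"
  proof (rule bounded_linear_intro[where K = "\<bar>K\<bar>"])
    show "norm (Abs_ell2 (f x)) \<le> norm x * \<bar>K\<bar>" for x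
      using nb[of x] by (simp add: mult.commute)
  qed (auto intro!: ell2_eqI simp: co f_def algebra_simps)
  then have T: "blinfun_apply (Blinfun (\<lambda>x. Abs_ell2 (f x))) x = Abs_ell2 (f x)" for x
    by (simp add: bounded_linear_Blinfun_apply)
  show ?thesis
  proof (rule that[of "Blinfun (\<lambda>x. Abs_ell2 (f x))"])
    show "Blinfun (\<lambda>x. Abs_ell2 (f x)) \<in> bounded_ops"
      unfolding bounded_ops_def by (auto intro!: ell2_eqI simp: T co f_def)
    show "blinfun_apply (Blinfun (\<lambda>x. Abs_ell2 (f x))) (basis_vec i)
        = (if i \<in> A then w i *\<^sub>C basis_vec (h i) else 0)" for i
      unfolding T by (rule ell2_eqI) (auto simp: co f_def g)
  qed (use nb in \<open>auto simp: T co f_def g_def\<close>)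
qed


section \<open>The strong, weak and weak-star operator topologies\<close>

definition SOT :: "'i ell2_op topology" where
  "SOT = subtopology strong_operator_topology bounded_ops"

definition WOT :: "'i ell2_op topology" where
  "WOT = pullback_topology bounded_ops (\<lambda>T. \<lambda>x y. cinner (blinfun_apply T x) y) euclidean"

definition hilbert_schmidt :: "'i ell2_op \<Rightarrow> bool" where
  "hilbert_schmidt A \<longleftrightarrow>
    A \<in> bounded_ops \<and> (\<lambda>i. (norm (blinfun_apply A (basis_vec i)))\<^sup>2) summable_on UNIV"

text \<open>Trace class operators are the products of two Hilbert-Schmidt operators.\<close>

definition trace_class :: "'i ell2_op \<Rightarrow> bool" where
  "trace_class A \<longleftrightarrow> (\<exists>B C. hilbert_schmidt B \<and> hilbert_schmidt C \<and> A = B o\<^sub>L C)"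

definition op_trace :: "'i ell2_op \<Rightarrow> complex" where
  "op_trace A = (\<Sum>\<^sub>\<infinity>i. cinner (blinfun_apply A (basis_vec i)) (basis_vec i))"

text \<open>The weak-star topology of the bounded operators as the dual of the trace class operators,
  under the pairing \<open>(T, A) \<mapsto> tr (T A)\<close>.\<close>

definition weak_star_topology :: "'i ell2_op topology" where
  "weak_star_topology =
    pullback_topology bounded_ops (\<lambda>T. \<lambda>A\<in>{A. trace_class A}. op_trace (T o\<^sub>L A))
      (product_topology (\<lambda>_. euclidean) {A. trace_class A})"

text \<open>The set of limits of sequences, not the smallest sequentially closed superset.\<close>

definition seq_closure :: "'a topology \<Rightarrow> 'a set \<Rightarrow> 'a set" where
  "seq_closure \<tau> S = {T. \<exists>s :: nat \<Rightarrow> 'a. range s \<subseteq> S \<and> limitin \<tau> s T sequentially}"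


section \<open>Free holomorphic functions in a neighborhood of the origin\<close>

text \<open>Words of the free semigroup on the generators indexed by \<open>'n\<close> are lists, the
  identity is the empty list, and multiplication is concatenation.\<close>

text \<open>The square root of the norm of \<open>\<Sum>\<^sub>i X\<^sub>i X\<^sub>i\<^sup>*\<close>.\<close>

definition row_norm :: "('n::finite \<Rightarrow> 'i ell2_op) \<Rightarrow> real" where
  "row_norm X = sqrt (onorm (\<lambda>x. \<Sum>i\<in>UNIV. blinfun_apply (X i) (adjoint (blinfun_apply (X i)) x)))"

definition converges_on_ball :: "'i itself \<Rightarrow> ('n::finite list \<Rightarrow> complex) \<Rightarrow> real \<Rightarrow> bool" where
  "converges_on_ball _ c \<rho> \<longleftrightarrow>
    (\<forall>X :: 'n \<Rightarrow> 'i ell2_op. range X \<subseteq> bounded_ops \<longrightarrow> row_norm X \<le> \<rho> \<longrightarrow>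
      summable (\<lambda>k. \<Sum>\<alpha> | length \<alpha> = k. op_scale (c \<alpha>) (op_word X \<alpha>)))"

text \<open>A definition in HOL cannot quantify over all Hilbert spaces, so convergence is required on
  the separable infinite-dimensional one. By \<open>converges_on_ball_all\<close> below, every smaller
  radius then works for \<open>'i ell2\<close> over every index type \<open>'i\<close>, that is, up to unitary equivalence,
  for every nonzero Hilbert space.\<close>

definition free_holomorphic_near_0 :: "('n::finite list \<Rightarrow> complex) \<Rightarrow> bool" where
  "free_holomorphic_near_0 c \<longleftrightarrow> (\<exists>\<rho>>0. converges_on_ball TYPE(nat) c \<rho>)"



lemma finite_words [simp]: "finite {\<alpha> :: 'n::finite list. length \<alpha> = k}"
  using finite_lists_length_eq[of "UNIV :: 'n set" k] by simp

lemma sum_words_Suc: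
  fixes F :: "'n::finite list \<Rightarrow> real"
  shows "(\<Sum>\<alpha> | length \<alpha> = Suc k. F \<alpha>) = (\<Sum>i\<in>UNIV. \<Sum>\<alpha> | length \<alpha> = k. F (i # \<alpha>))"
proof -
  have "{\<alpha> :: 'n list. length \<alpha> = Suc k} = (\<lambda>(i, \<alpha>). i # \<alpha>) ` (UNIV \<times> {\<alpha>. length \<alpha> = k})"
    by (auto simp: length_Suc_conv image_iff)
  then have "(\<Sum>\<alpha> | length \<alpha> = Suc k. F \<alpha>) = (\<Sum>(i, \<alpha>)\<in>UNIV \<times> {\<alpha>. length \<alpha> = k}. F (i # \<alpha>))"
    by (simp add: sum.reindex inj_on_def case_prod_unfold)
  then show ?thesis by (simp add: sum.cartesian_product)
qed

lemma bounded_linear_adjoint_op: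
  assumes T: "T \<in> bounded_ops"
  shows "bounded_linear (adjoint (blinfun_apply T))"
proof -
  let ?A = "adjoint (blinfun_apply T)"
  have eq: "u = v" if "\<And>x. inner x u = inner x v" for u v :: "'a ell2"
    using that by (metis inner_commute vector_eq_rdot)
  have "norm (?A y) \<le> norm y * norm T" for y
  proof -
    have "norm (?A y) * norm (?A y) = inner (blinfun_apply T (?A y)) y"
      by (simp add: adjoint_op[OF T] flip: power2_eq_square power2_norm_eq_inner)
    also have "\<dots> \<le> norm (blinfun_apply T (?A y)) * norm y" by (rule norm_cauchy_schwarz)
    also have "\<dots> \<le> (norm T * norm (?A y)) * norm y"
      by (intro mult_right_mono norm_blinfun) auto
    finally have "norm (?A y) * norm (?A y) \<le> (norm y * norm T) * norm (?A y)"
      by (simp add: ac_simps)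
    then show ?thesis
      by (cases "?A y = 0") (auto dest: mult_right_le_imp_le)
  qed
  then show ?thesis
    by (intro bounded_linear_intro[of _ "norm T"] eq)
       (simp_all add: adjoint_op[OF T, symmetric] inner_add_right)
qed

lemma op_word_bounded:
  assumes "range X \<subseteq> bounded_ops"
  shows "op_word X \<alpha> \<in> bounded_ops"
proof -
  have "X i \<in> bounded_ops" for i using assms by auto
  then show ?thesis by (induction \<alpha>) (simp_all add: bounded_ops_def)
qed

lemma converges_imp_growth:
  fixes c :: "'n::finite list \<Rightarrow> complex"
  assumes conv: "converges_on_ball TYPE(nat) c \<rho>" and \<rho>: "\<rho> > 0"
  obtains C where "\<And>k. \<rho> ^ k * L2_set (\<lambda>\<alpha>. cmod (c \<alpha>)) {\<alpha>. length \<alpha> = k} \<le> C"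
proof -
  have "countable (lists (UNIV :: 'n set))" by (intro countable_lists countable_finite) simp
  then obtain f :: "'n list \<Rightarrow> nat" where f: "inj f" unfolding countable_def by auto
  have f': "f \<alpha> = f \<beta> \<longleftrightarrow> \<alpha> = \<beta>" for \<alpha> \<beta> using f by (auto dest: injD)
  define h where "h i m = f (i # inv f m)" for i m
  have hf: "h i (f \<alpha>) = f (i # \<alpha>)" for i \<alpha> by (simp add: h_def f)
  have inj: "inj_on (h i) (range f)" for i by (auto simp: inj_on_def hf f')
  have "\<exists>T \<in> bounded_ops. (\<forall>\<alpha>. blinfun_apply T (basis_vec (f \<alpha>)) = of_real \<rho> *\<^sub>C basis_vec (f (i # \<alpha>))) \<and>
      (\<forall>x j. j \<notin> h i ` range f \<longrightarrow> coord (blinfun_apply T x) j = 0) \<and>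
      (\<forall>x. norm (blinfun_apply T x) \<le> \<rho> * norm x)" for i
  proof (rule weighted_shift[OF inj[of i], of "\<lambda>_. of_real \<rho>" \<rho>], goal_cases)
    case (2 T)
    then show ?case using \<rho> by (intro bexI[of _ T]) (simp_all add: hf)
  qed (use \<rho> in simp)
  then obtain X where X: "\<And>i. X i \<in> bounded_ops"
    and Xb: "\<And>i \<alpha>. blinfun_apply (X i) (basis_vec (f \<alpha>)) = of_real \<rho> *\<^sub>C basis_vec (f (i # \<alpha>))"
    and X0: "\<And>i x j. j \<notin> h i ` range f \<Longrightarrow> coord (blinfun_apply (X i) x) j = 0"
    and Xn: "\<And>i x. norm (blinfun_apply (X i) x) \<le> \<rho> * norm x"
    by metis
  have orth: "inner (blinfun_apply (X i) x) (blinfun_apply (X j) y) = 0" if "i \<noteq> j" for i j x y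
  proof -
    have z: "coord (blinfun_apply (X i) x) m * cnj (coord (blinfun_apply (X j) y) m) = 0" for m
    proof -
      have "m \<notin> h i ` range f \<or> m \<notin> h j ` range f" using that by (auto simp: hf f')
      then show ?thesis using X0 by auto
    qed
    show ?thesis
      unfolding inner_ell2_def cinner_def by (simp only: z infsum_0_simp zero_complex.sel)
  qed
  have word: "blinfun_apply (op_word X \<alpha>) (basis_vec (f [])) = of_real (\<rho> ^ length \<alpha>) *\<^sub>C basis_vec (f \<alpha>)" for \<alpha>
    by (induction \<alpha>) (simp_all add: bounded_opsD[OF X] Xb mult.commute)
  have "onorm (\<lambda>x. \<Sum>i\<in>UNIV. blinfun_apply (X i) (adjoint (blinfun_apply (X i)) x)) \<le> \<rho>\<^sup>2"
  proof (rule onorm_bound)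
    fix x
    define y where "y i = adjoint (blinfun_apply (X i)) x" for i
    define S where "S = (\<Sum>i\<in>UNIV. blinfun_apply (X i) (y i))"
    have "inner S S = (\<Sum>i\<in>UNIV. \<Sum>j\<in>UNIV. inner (blinfun_apply (X i) (y i)) (blinfun_apply (X j) (y j)))"
      unfolding S_def inner_sum_left by (simp only: inner_sum_right)
    also have "\<dots> = (\<Sum>i\<in>UNIV. \<Sum>j\<in>UNIV. if j = i then (norm (blinfun_apply (X i) (y i)))\<^sup>2 else 0)"
      by (intro sum.cong refl) (auto simp: orth power2_norm_eq_inner)
    also have "\<dots> = (\<Sum>i\<in>UNIV. (norm (blinfun_apply (X i) (y i)))\<^sup>2)" by simp
    also have "\<dots> \<le> (\<Sum>i\<in>UNIV. \<rho>\<^sup>2 * (norm (y i))\<^sup>2)"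
      unfolding power_mult_distrib[symmetric] by (intro sum_mono power_mono Xn) auto
    also have "\<dots> = \<rho>\<^sup>2 * (\<Sum>i\<in>UNIV. inner (blinfun_apply (X i) (y i)) x)"
      by (simp add: adjoint_op[OF X] power2_norm_eq_inner y_def sum_distrib_left)
    also have "\<dots> = \<rho>\<^sup>2 * inner S x" by (simp add: S_def inner_sum_left)
    also have "\<dots> \<le> \<rho>\<^sup>2 * (norm S * norm x)" by (intro mult_left_mono norm_cauchy_schwarz) auto
    finally have "norm S * norm S \<le> (\<rho>\<^sup>2 * norm x) * norm S"
      by (simp add: ac_simps flip: power2_eq_square power2_norm_eq_inner)
    then have "norm S \<le> \<rho>\<^sup>2 * norm x"
      by (cases "S = 0") (auto dest: mult_right_le_imp_le)
    then show "norm (\<Sum>i\<in>UNIV. blinfun_apply (X i) (adjoint (blinfun_apply (X i)) x)) \<le> \<rho>\<^sup>2 * norm x"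
      by (simp add: S_def y_def)
  qed simp
  then have "row_norm X \<le> \<rho>"
    unfolding row_norm_def using \<rho> by (simp add: real_le_lsqrt)
  then have "summable (\<lambda>k. \<Sum>\<alpha> | length \<alpha> = k. op_scale (c \<alpha>) (op_word X \<alpha>))"
    using conv X unfolding converges_on_ball_def by blast
  then have "Bseq (\<lambda>k. \<Sum>\<alpha> | length \<alpha> = k. op_scale (c \<alpha>) (op_word X \<alpha>))"
    by (intro convergent_imp_Bseq) (auto dest: summable_LIMSEQ_zero simp: convergent_def)
  then obtain C where C: "\<And>k. norm (\<Sum>\<alpha> | length \<alpha> = k. op_scale (c \<alpha>) (op_word X \<alpha>)) \<le> C"
    unfolding Bseq_def by blast
  have nb: "norm (basis_vec m :: nat ell2) = 1" for m
    using norm_basis_sum[of "{m}" "\<lambda>_. 1"] by (simp add: power2_eq_1_iff) (smt (verit) norm_ge_zero)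
  show ?thesis
  proof (rule that)
    fix k
    let ?L = "{\<alpha> :: 'n list. length \<alpha> = k}"
    let ?B = "\<Sum>\<alpha>\<in>?L. op_scale (c \<alpha>) (op_word X \<alpha>)"
    have "blinfun_apply ?B (basis_vec (f [])) = (\<Sum>\<alpha>\<in>?L. (of_real (\<rho> ^ k) * c \<alpha>) *\<^sub>C basis_vec (f \<alpha>))"
      by (simp add: blinfun.sum_left word mult.commute)
    also have "\<dots> = (\<Sum>m\<in>f ` ?L. (of_real (\<rho> ^ k) * c (inv f m)) *\<^sub>C basis_vec m)"
      by (subst sum.reindex) (auto simp: f inj_on_def f')
    finally have "(norm (blinfun_apply ?B (basis_vec (f []))))\<^sup>2
        = (\<Sum>m\<in>f ` ?L. (cmod (of_real (\<rho> ^ k) * c (inv f m)))\<^sup>2)"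
      by (simp only: norm_basis_sum finite_words finite_imageI)
    also have "\<dots> = (\<Sum>\<alpha>\<in>?L. (\<rho> ^ k * cmod (c \<alpha>))\<^sup>2)"
      by (subst sum.reindex) (use \<rho> in \<open>auto simp: f inj_on_def f' norm_mult norm_power\<close>)
    finally have sq: "(norm (blinfun_apply ?B (basis_vec (f []))))\<^sup>2 = (\<Sum>\<alpha>\<in>?L. (\<rho> ^ k * cmod (c \<alpha>))\<^sup>2)" .
    have "norm (blinfun_apply ?B (basis_vec (f []))) = L2_set (\<lambda>\<alpha>. \<rho> ^ k * cmod (c \<alpha>)) ?L"
      unfolding L2_set_def by (rule real_sqrt_unique[OF sq norm_ge_zero, symmetric])
    also have "\<dots> = \<rho> ^ k * L2_set (\<lambda>\<alpha>. cmod (c \<alpha>)) ?L"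
      using \<rho> by (simp add: L2_set_right_distrib)
    finally show "\<rho> ^ k * L2_set (\<lambda>\<alpha>. cmod (c \<alpha>)) ?L \<le> C"
      using norm_blinfun[of ?B "basis_vec (f [])"] C[of k] nb by simp
  qed
qed

lemma row_contraction_words:
  fixes X :: "'n::finite \<Rightarrow> 'i ell2_op"
  assumes X: "range X \<subseteq> bounded_ops" and r: "row_norm X \<le> r"
  shows "norm (\<Sum>\<alpha> | length \<alpha> = k. op_scale (c \<alpha>) (op_word X \<alpha>))
    \<le> r ^ k * L2_set (\<lambda>\<alpha>. cmod (c \<alpha>)) {\<alpha>. length \<alpha> = k}"
proof -
  let ?adj = "\<lambda>i. adjoint (blinfun_apply (X i))"
  let ?R = "\<lambda>x. \<Sum>i\<in>UNIV. blinfun_apply (X i) (?adj i x)"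
  have X': "X i \<in> bounded_ops" for i using X by auto
  have bl: "bounded_linear ?R"
    by (intro bounded_linear_sum bounded_linear_compose[OF blinfun.bounded_linear_right]
        bounded_linear_adjoint_op X')
  have "0 \<le> onorm ?R" by (rule onorm_pos_le[OF bl])
  then have r0: "0 \<le> r" using r unfolding row_norm_def by (meson order_trans real_sqrt_ge_zero)
  have on: "onorm ?R \<le> r\<^sup>2" using r unfolding row_norm_def by (rule sqrt_le_D)
  have one: "(\<Sum>i\<in>UNIV. (norm (?adj i y))\<^sup>2) \<le> r\<^sup>2 * (norm y)\<^sup>2" for y
  proof -
    have "(\<Sum>i\<in>UNIV. (norm (?adj i y))\<^sup>2) = inner (?R y) y"
      by (simp add: inner_sum_left adjoint_op[OF X'] power2_norm_eq_inner)
    also have "\<dots> \<le> norm (?R y) * norm y" by (rule norm_cauchy_schwarz)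
    also have "\<dots> \<le> (onorm ?R * norm y) * norm y" by (intro mult_right_mono onorm[OF bl]) auto
    also have "\<dots> \<le> (r\<^sup>2 * norm y) * norm y" by (intro mult_right_mono on) auto
    finally show ?thesis by (simp add: power2_eq_square mult.assoc)
  qed
  define adjw where "adjw = rec_list (\<lambda>y. y) (\<lambda>i _ A y. A (?adj i y))"
  have adjw [simp]: "adjw [] y = y" "adjw (i # \<alpha>) y = adjw \<alpha> (?adj i y)" for i \<alpha> y
    by (simp_all add: adjw_def)
  have adj: "inner (blinfun_apply (op_word X \<alpha>) x) y = inner x (adjw \<alpha> y)" for \<alpha> x y
    by (induction \<alpha> arbitrary: y) (simp_all add: adjoint_op[OF X'])
  have words: "(\<Sum>\<alpha> | length \<alpha> = k. (norm (adjw \<alpha> y))\<^sup>2) \<le> (r ^ k * norm y)\<^sup>2" for k y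
  proof (induction k arbitrary: y)
    case (Suc k)
    have "(\<Sum>\<alpha> | length \<alpha> = Suc k. (norm (adjw \<alpha> y))\<^sup>2)
        = (\<Sum>i\<in>UNIV. \<Sum>\<alpha> | length \<alpha> = k. (norm (adjw \<alpha> (?adj i y)))\<^sup>2)"
      by (simp add: sum_words_Suc)
    also have "\<dots> \<le> (\<Sum>i\<in>UNIV. (r ^ k * norm (?adj i y))\<^sup>2)" by (intro sum_mono Suc)
    also have "\<dots> = (r ^ k)\<^sup>2 * (\<Sum>i\<in>UNIV. (norm (?adj i y))\<^sup>2)"
      by (simp add: power_mult_distrib sum_distrib_left)
    also have "\<dots> \<le> (r ^ k)\<^sup>2 * (r\<^sup>2 * (norm y)\<^sup>2)" by (intro mult_left_mono one) auto
    also have "\<dots> = (r ^ Suc k * norm y)\<^sup>2" by (simp add: power_mult_distrib)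
    finally show ?case .
  qed simp
  let ?L = "{\<alpha> :: 'n list. length \<alpha> = k}"
  let ?B = "\<Sum>\<alpha>\<in>?L. op_scale (c \<alpha>) (op_word X \<alpha>)"
  let ?c = "L2_set (\<lambda>\<alpha>. cmod (c \<alpha>)) ?L"
  show ?thesis
  proof (rule norm_blinfun_bound)
    show "0 \<le> r ^ k * ?c" using r0 by simp
    fix x
    define y where "y = blinfun_apply ?B x"
    have "norm y * norm y = inner (blinfun_apply ?B x) y"
      by (simp add: y_def flip: power2_eq_square power2_norm_eq_inner)
    also have "\<dots> = (\<Sum>\<alpha>\<in>?L. inner (c \<alpha> *\<^sub>C x) (adjw \<alpha> y))"
      by (simp add: blinfun.sum_left inner_sum_left bounded_opsD[OF op_word_bounded[OF X], symmetric] adj)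
    also have "\<dots> \<le> (\<Sum>\<alpha>\<in>?L. norm x * (\<bar>cmod (c \<alpha>)\<bar> * \<bar>norm (adjw \<alpha> y)\<bar>))"
      by (intro sum_mono order_trans[OF norm_cauchy_schwarz]) (simp add: ac_simps)
    also have "\<dots> \<le> norm x * (?c * L2_set (\<lambda>\<alpha>. norm (adjw \<alpha> y)) ?L)"
      unfolding sum_distrib_left[symmetric] by (intro mult_left_mono L2_set_mult_ineq) auto
    also have "\<dots> \<le> norm x * (?c * (r ^ k * norm y))"
    proof (intro mult_left_mono)
      show "L2_set (\<lambda>\<alpha>. norm (adjw \<alpha> y)) ?L \<le> r ^ k * norm y"
        unfolding L2_set_def by (rule real_le_lsqrt) (use words r0 in \<open>auto simp: sum_nonneg\<close>)
    qed auto
    finally have "norm y * norm y \<le> (r ^ k * ?c * norm x) * norm y"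
      by (simp add: ac_simps)
    then have "norm y \<le> r ^ k * ?c * norm x"
      using r0 by (cases "y = 0") (auto dest: mult_right_le_imp_le)
    then show "norm (blinfun_apply ?B x) \<le> r ^ k * ?c * norm x" by (simp add: y_def)
  qed
qed

lemma converges_on_ball_all:
  fixes c :: "'n::finite list \<Rightarrow> complex"
  assumes "converges_on_ball TYPE(nat) c \<rho>" and "0 < r" "r < \<rho>"
  shows "converges_on_ball TYPE('i) c r"
  unfolding converges_on_ball_def
proof (intro allI impI)
  fix X :: "'n \<Rightarrow> 'i ell2_op"
  assume X: "range X \<subseteq> bounded_ops" "row_norm X \<le> r"
  obtain C where C: "\<And>k. \<rho> ^ k * L2_set (\<lambda>\<alpha>. cmod (c \<alpha>)) {\<alpha>. length \<alpha> = k} \<le> C"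
    using converges_imp_growth[OF assms(1)] assms by auto
  show "summable (\<lambda>k. \<Sum>\<alpha> | length \<alpha> = k. op_scale (c \<alpha>) (op_word X \<alpha>))"
  proof (rule summable_comparison_test')
    show "summable (\<lambda>k. C * (r / \<rho>) ^ k)"
      by (intro summable_mult summable_geometric) (use assms in auto)
    fix k
    have "norm (\<Sum>\<alpha> | length \<alpha> = k. op_scale (c \<alpha>) (op_word X \<alpha>))
        \<le> r ^ k * L2_set (\<lambda>\<alpha>. cmod (c \<alpha>)) {\<alpha>. length \<alpha> = k}"
      by (rule row_contraction_words[OF X])
    also have "\<dots> = (r / \<rho>) ^ k * (\<rho> ^ k * L2_set (\<lambda>\<alpha>. cmod (c \<alpha>)) {\<alpha>. length \<alpha> = k})"
      using assms by (simp add: power_divide)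
    also have "\<dots> \<le> (r / \<rho>) ^ k * C"
      by (intro mult_left_mono C) (use assms in auto)
    finally show "norm (\<Sum>\<alpha> | length \<alpha> = k. op_scale (c \<alpha>) (op_word X \<alpha>)) \<le> C * (r / \<rho>) ^ k"
      by (simp add: mult.commute)
  qed
qed


section \<open>The Hardy algebra\<close>

type_synonym 'n fock = "'n list ell2"

text \<open>The description is proper as soon as the weights are positive and the quotients
  \<open>b \<alpha> / b (i # \<alpha>)\<close> are bounded; see the lemma that follows.\<close>

definition weighted_creation :: "('n list \<Rightarrow> real) \<Rightarrow> 'n \<Rightarrow> 'n list ell2_op" where
  "weighted_creation b i = (THE T. T \<in> bounded_ops \<and>
    (\<forall>\<alpha>. blinfun_apply T (basis_vec \<alpha>) = of_real (sqrt (b \<alpha> / b (i # \<alpha>))) *\<^sub>C basis_vec (i # \<alpha>)))"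

lemma weighted_creation:
  assumes pos: "\<And>\<alpha>. b \<alpha> > 0" and bdd: "bdd_above (range (\<lambda>\<alpha>. b \<alpha> / b (i # \<alpha>)))"
  shows "weighted_creation b i \<in> bounded_ops"
    and "blinfun_apply (weighted_creation b i) (basis_vec \<alpha>)
      = of_real (sqrt (b \<alpha> / b (i # \<alpha>))) *\<^sub>C basis_vec (i # \<alpha>)"
proof -
  let ?P = "\<lambda>T. T \<in> bounded_ops \<and>
    (\<forall>\<alpha>. blinfun_apply T (basis_vec \<alpha>) = of_real (sqrt (b \<alpha> / b (i # \<alpha>))) *\<^sub>C basis_vec (i # \<alpha>))"
  obtain K where K: "\<And>\<alpha>. b \<alpha> / b (i # \<alpha>) \<le> K" using bdd by (auto simp: bdd_above_def)
  have inj: "inj_on ((#) i) UNIV" by auto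
  have le: "cmod (of_real (sqrt (b \<alpha> / b (i # \<alpha>)))) \<le> sqrt K" for \<alpha>
    using real_sqrt_le_mono[OF K[of \<alpha>]] pos[of \<alpha>] pos[of "i # \<alpha>"] by (simp add: abs_of_pos)
  obtain T where "?P T"
    by (rule weighted_shift[OF inj, of "\<lambda>\<alpha>. of_real (sqrt (b \<alpha> / b (i # \<alpha>)))" "sqrt K"]) (use le in auto)
  then have "\<exists>!T. ?P T" by (auto intro: bounded_ops_eqI)
  from theI'[OF this] show "weighted_creation b i \<in> bounded_ops"
    and "blinfun_apply (weighted_creation b i) (basis_vec \<alpha>)
      = of_real (sqrt (b \<alpha> / b (i # \<alpha>))) *\<^sub>C basis_vec (i # \<alpha>)"
    by (auto simp: weighted_creation_def)
qed

definition fock_polynomials :: "'n fock set" where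
  "fock_polynomials = {\<Sum>\<alpha>\<in>F. a \<alpha> *\<^sub>C basis_vec \<alpha> | F a. finite F}"

definition op_polynomials :: "('n \<Rightarrow> 'i ell2_op) \<Rightarrow> 'i ell2_op set" where
  "op_polynomials X = {\<Sum>\<alpha>\<in>F. op_scale (a \<alpha>) (op_word X \<alpha>) | F a. finite F}"

text \<open>The operators given by formal series \<open>\<Sum> c\<^sub>\<beta> W\<^sub>\<beta>\<close>. Sums over the semigroup are unconditional, in the
  norm of the Fock space. The first condition says precisely that the series converges at every
  \<open>e\<^sub>\<gamma>\<close>, hence at every polynomial: its terms at \<open>e\<^sub>\<gamma>\<close> are pairwise orthogonal.\<close>

definition hardy_algebra :: "('n list \<Rightarrow> real) \<Rightarrow> 'n list ell2_op set" where
  "hardy_algebra b = {\<phi> \<in> bounded_ops. \<exists>c :: 'n list \<Rightarrow> complex.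
    (\<forall>\<gamma>. (\<lambda>\<beta>. (cmod (c \<beta>))\<^sup>2 * (b \<gamma> / b (\<beta> @ \<gamma>))) summable_on UNIV) \<and>
    bdd_above ((\<lambda>p. norm (\<Sum>\<^sub>\<infinity>\<beta>. c \<beta> *\<^sub>C blinfun_apply (op_word (weighted_creation b) \<beta>) p)) `
      {p \<in> fock_polynomials. norm p \<le> 1}) \<and>
    (\<forall>p\<in>fock_polynomials.
      ((\<lambda>\<beta>. c \<beta> *\<^sub>C blinfun_apply (op_word (weighted_creation b) \<beta>) p) has_sum blinfun_apply \<phi> p) UNIV)}"

end

theory Submission
  imports Defs
begin

text \<open>A bounded operator belongs to the Hardy algebra exactly when its matrix entry at
  \<open>(\<beta>\<gamma>, \<gamma>)\<close> is \<open>c\<^sub>\<beta> (b\<^sub>\<gamma> / b\<^sub>\<beta>\<^sub>\<gamma>)\<^sup>1\<^sup>/\<^sup>2\<close> for some family \<open>c\<close>, and all other entries vanish. After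
  eliminating \<open>c\<close>, these are linear conditions on matrix entries, so the Hardy algebra is closed in
  every topology in which the entries are continuous. Conversely, the Cesaro means of the
  formal series are polynomials of norm at most that of the operator and converge to it
  strongly; bounded strongly convergent sequences also converge weakly and weak-star.\<close>

section \<open>Square-summable families and bounded operators\<close>

text \<open>Why Cesaro means: cutting the formal series off at a word length converges on every
  basis vector, but the cut-offs are in general not uniformly bounded in norm. A uniform bound is
  what carries convergence from basis vectors to all vectors, and from vectors to traces against
  trace class operators. The bound on the means comes from the grading by length. Since
  \<open>W \<beta>\<close> raises length by \<open>length \<beta>\<close>, the factor
  \<open>1 - length \<beta> / N\<close> at the entry with row \<open>\<alpha>\<close> and column
  \<open>\<gamma>\<close> depends only on the difference of the lengths of \<open>\<alpha>\<close>
  and \<open>\<gamma>\<close>. It thus acts as an entrywise multiplier that can be compared with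
  averages of diagonal compressions, whatever the weights are. The coefficients are eliminated
  through the column of the empty word, which alone determines \<open>c\<close>; every other column
  must agree with it after rescaling.\<close>

lemma cinner_basis_right [simp]: "cinner x (basis_vec i) = coord x i"
proof -
  have "cinner x (basis_vec i) = (\<Sum>\<^sub>\<infinity>j\<in>{i}. coord x j * cnj (coord (basis_vec i) j))"
    unfolding cinner_def by (rule infsum_cong_neutral) auto
  then show ?thesis by simp
qed

lemma norm_basis_vec [simp]: "norm (basis_vec i) = 1"
  using norm_basis_sum[of "{i}" "\<lambda>_. 1"] by (simp add: power2_eq_1_iff) (smt (verit) norm_ge_zero)

lemma bounded_linear_coord: "bounded_linear (\<lambda>x. coord x i)"
  by (rule bounded_linear_intro[of _ 1]) (auto simp: coord_le_norm scaleR_conv_of_real)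

lemma bounded_linear_cinner_left: "bounded_linear (\<lambda>x. cinner x y)"
  by (rule bounded_linear_intro[of _ "norm y"])
    (auto simp: cinner_add_left scaleR_cscale cinner_cscale_left scaleR_conv_of_real cinner_Cauchy_Schwarz)

section \<open>Coordinatewise domination and limits tested on basis vectors\<close>

lemma norm_mono_coord:
  assumes "\<And>i. cmod (coord x i) \<le> cmod (coord y i)"
  shows "norm x \<le> norm y"
proof (rule norm_ell2_leI)
  fix F :: "'a set" assume F: "finite F"
  have "(\<Sum>i\<in>F. (cmod (coord x i))\<^sup>2) \<le> (\<Sum>i\<in>F. (cmod (coord y i))\<^sup>2)"
    by (intro sum_mono power_mono assms) auto
  with sum_coord_le_norm[OF F, of y] show "(\<Sum>i\<in>F. (cmod (coord x i))\<^sup>2) \<le> (norm y)\<^sup>2" by linarith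
qed simp

lemma coord_finite_sum:
  assumes "finite F"
  shows "coord (\<Sum>i\<in>F. a i *\<^sub>C basis_vec i) j = (if j \<in> F then a j else 0)"
  using assms by (simp add: if_distrib[of "\<lambda>t. _ * t"] sum.delta cong: if_cong)

lemma finite_approx:
  assumes "e > 0"
  obtains F where "finite F" "norm (x - (\<Sum>i\<in>F. coord x i *\<^sub>C basis_vec i)) < e"
proof -
  have "\<forall>\<^sub>F F in finite_subsets_at_top UNIV. dist (\<Sum>i\<in>F. coord x i *\<^sub>C basis_vec i) x < e"
    using ell2_expansion[of x] assms unfolding has_sum_def tendsto_iff by blast
  then obtain F where "finite F" "dist (\<Sum>i\<in>F. coord x i *\<^sub>C basis_vec i) x < e"
    by (auto simp: eventually_finite_subsets_at_top)
  then show ?thesis using that by (simp add: dist_norm norm_minus_commute)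
qed

text \<open>Dominated convergence for square-summable families. It yields norm convergence of the
  Cesaro means on a single basis vector.\<close>

lemma tendsto_zero_dominated_coord:
  fixes v :: "nat \<Rightarrow> 'i ell2"
  assumes dom: "\<And>n i. cmod (coord (v n) i) \<le> cmod (coord a i)"
    and lim: "\<And>i. (\<lambda>n. coord (v n) i) \<longlonglongrightarrow> 0"
  shows "v \<longlonglongrightarrow> 0"
proof (rule LIMSEQ_I)
  fix e :: real assume e: "e > 0"
  obtain F where F: "finite F" "norm (a - (\<Sum>i\<in>F. coord a i *\<^sub>C basis_vec i)) < e/2"
    using finite_approx[of "e/2" a] e by auto
  have "(\<lambda>n. \<Sum>i\<in>F. cmod (coord (v n) i)) \<longlonglongrightarrow> (\<Sum>i\<in>F. 0)"
    by (intro tendsto_sum tendsto_norm_zero lim)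
  then obtain N where N: "\<And>n. n \<ge> N \<Longrightarrow> (\<Sum>i\<in>F. cmod (coord (v n) i)) < e/2"
    using LIMSEQ_D[of _ 0 "e/2"] e by (fastforce simp: sum_nonneg)
  have "norm (v n) < e" if n: "n \<ge> N" for n
  proof -
    let ?s = "\<lambda>x. \<Sum>i\<in>F. coord x i *\<^sub>C basis_vec i"
    have "norm (v n) \<le> norm (v n - ?s (v n)) + norm (?s (v n))"
      using norm_triangle_ineq[of "v n - ?s (v n)" "?s (v n)"] by simp
    \<comment> \<open>Off \<open>F\<close> every \<open>v n\<close> is dominated by the small tail
      of \<open>a\<close>, uniformly in \<open>n\<close>; on \<open>F\<close> only finitely many
      coordinates have to converge.\<close>
    moreover have "norm (v n - ?s (v n)) \<le> norm (a - ?s a)"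
      by (rule norm_mono_coord) (simp add: coord_finite_sum[OF F(1)] dom del: coord_sum)
    moreover have "norm (?s (v n)) \<le> (\<Sum>i\<in>F. cmod (coord (v n) i))"
      by (rule sum_norm_le) simp
    ultimately show ?thesis using F(2) N[OF n] by linarith
  qed
  then show "\<exists>N. \<forall>n\<ge>N. norm (v n - 0) < e" by auto
qed

lemma bounded_ops_diff: "S \<in> bounded_ops \<Longrightarrow> T \<in> bounded_ops \<Longrightarrow> S - T \<in> bounded_ops"
  unfolding bounded_ops_def
  by (auto simp: blinfun.diff_left intro!: ell2_eqI simp: algebra_simps)

lemma bounded_ops_compose: "S \<in> bounded_ops \<Longrightarrow> T \<in> bounded_ops \<Longrightarrow> S o\<^sub>L T \<in> bounded_ops"
  by (simp add: bounded_ops_def)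

lemma apply_finite_sum:
  assumes "T \<in> bounded_ops"
  shows "blinfun_apply T (\<Sum>i\<in>F. a i *\<^sub>C x i) = (\<Sum>i\<in>F. a i *\<^sub>C blinfun_apply T (x i))"
  by (simp add: blinfun.sum_right bounded_opsD[OF assms])

text \<open>Finite combinations of basis vectors are dense, and the common norm bound makes the
  approximation error uniform in \<open>n\<close>.\<close>

lemma strong_limit_from_basis:
  assumes D: "\<And>n. D n \<in> bounded_ops" and K: "\<And>n. norm (D n) \<le> K"
    and lim: "\<And>i. (\<lambda>n. blinfun_apply (D n) (basis_vec i)) \<longlonglongrightarrow> 0"
  shows "(\<lambda>n. blinfun_apply (D n) x) \<longlonglongrightarrow> 0"
proof (rule LIMSEQ_I)
  fix e :: real assume e: "e > 0"
  \<comment> \<open>The summand 1 keeps \<open>L\<close> positive, so that the error can be chosen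
    below \<open>e/2/L\<close>.\<close>
  define L where "L = \<bar>K\<bar> + 1"
  have L: "L > 0" "\<And>n. norm (D n) \<le> L" using K by (auto simp: L_def) (smt (verit) K)
  let ?s = "\<lambda>F. \<Sum>i\<in>F. coord x i *\<^sub>C basis_vec i"
  obtain F where F: "finite F" "norm (x - ?s F) < e/2/L"
    using finite_approx[of "e/2/L" x] e L by auto
  have "(\<lambda>n. \<Sum>i\<in>F. cmod (coord x i) * norm (blinfun_apply (D n) (basis_vec i))) \<longlonglongrightarrow> (\<Sum>i\<in>F. cmod (coord x i) * 0)"
    by (intro tendsto_sum tendsto_mult_left tendsto_norm_zero lim)
  then obtain N where N: "\<And>n. n \<ge> N \<Longrightarrow> (\<Sum>i\<in>F. cmod (coord x i) * norm (blinfun_apply (D n) (basis_vec i))) < e/2"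
    using LIMSEQ_D[of _ 0 "e/2"] e by (fastforce simp: sum_nonneg)
  have "norm (blinfun_apply (D n) x) < e" if n: "n \<ge> N" for n
  proof -
    have "blinfun_apply (D n) x = blinfun_apply (D n) (x - ?s F) + blinfun_apply (D n) (?s F)"
      by (simp add: blinfun.diff_right)
    then have "norm (blinfun_apply (D n) x) \<le> norm (blinfun_apply (D n) (x - ?s F)) + norm (blinfun_apply (D n) (?s F))"
      by (metis norm_triangle_ineq)
    moreover have "norm (blinfun_apply (D n) (x - ?s F)) \<le> L * norm (x - ?s F)"
      by (rule order_trans[OF norm_blinfun mult_right_mono]) (use L in auto)
    moreover have "L * norm (x - ?s F) < e/2" using F(2) L by (simp add: field_simps)
    moreover have "norm (blinfun_apply (D n) (?s F)) \<le> (\<Sum>i\<in>F. cmod (coord x i) * norm (blinfun_apply (D n) (basis_vec i)))"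
      unfolding apply_finite_sum[OF D] by (rule sum_norm_le) simp
    ultimately show ?thesis using N[OF n] by linarith
  qed
  then show "\<exists>N. \<forall>n\<ge>N. norm (blinfun_apply (D n) x - 0) < e" by auto
qed

text \<open>The multiplier counts the windows \<open>{k - N<..k}\<close> that contain both \<open>len i\<close> and \<open>len j\<close>, so \<open>N S\<close> is the
  sum of the compressions of \<open>T\<close> to the windows. Every index lies in exactly \<open>N\<close> of them, and Cauchy-Schwarz
  over the windows gives the bound without the Fejer kernel.\<close>

lemma norm_window_average_le:
  fixes S T :: "'i ell2_op" and len :: "'i \<Rightarrow> nat"
  assumes S: "S \<in> bounded_ops" and T: "T \<in> bounded_ops" and N: "N > 0"
    and avg: "\<And>i j. of_nat N * coord (blinfun_apply S (basis_vec j)) i =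
      of_nat (card ({len i..<len i + N} \<inter> {len j..<len j + N})) * coord (blinfun_apply T (basis_vec j)) i"
  shows "norm S \<le> norm T"
proof (rule norm_blinfun_bound)
  show "norm T \<ge> 0" by simp
  \<comment> \<open>For finitely supported \<open>x\<close> only finitely many windows matter;
    density and continuity extend the bound at the end.\<close>
  have fin: "norm (blinfun_apply S x) \<le> norm T * norm x"
    if A: "finite A" and x: "x = (\<Sum>j\<in>A. a j *\<^sub>C basis_vec j)" for x A and a :: "'i \<Rightarrow> complex"
  proof (rule norm_ell2_leI)
    fix F :: "'i set" assume F: "finite F"
    define u where "u i = coord (blinfun_apply S x) i" for i
    define s where "s = (\<Sum>i\<in>F. (cmod (u i))\<^sup>2)"
    \<comment> \<open>No window with \<open>k \<ge> M\<close> contains the length of an index in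
      \<open>A \<union> F\<close>, so sums over \<open>k < M\<close> count each such index its full
      \<open>N\<close> times.\<close>
    obtain M where M: "\<And>i. i \<in> A \<union> F \<Longrightarrow> len i + N \<le> M"
      using finite_nat_set_iff_bounded_le[of "(\<lambda>i. len i + N) ` (A \<union> F)"] A F by auto
    define win where "win k i = (if len i \<le> k \<and> k < len i + N then 1 else 0 :: complex)" for k i
    \<comment> \<open>\<open>Q B f k\<close> is the part of the vector with coefficients
      \<open>f\<close> on \<open>B\<close> that lies in window \<open>k\<close>.\<close>
    define Q where "Q B f k = (\<Sum>i\<in>B. (win k i * f i) *\<^sub>C basis_vec i)" for B and f :: "'i \<Rightarrow> complex" and k
    have Qn: "(\<Sum>k<M. (norm (Q B f k))\<^sup>2) = N * (\<Sum>i\<in>B. (cmod (f i))\<^sup>2)"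
      if B: "finite B" "B \<subseteq> A \<union> F" for B f
    proof -
      have "(\<Sum>k<M. (norm (Q B f k))\<^sup>2) = (\<Sum>k<M. \<Sum>i\<in>B. (cmod (win k i * f i))\<^sup>2)"
        unfolding Q_def using B(1) by (simp only: norm_basis_sum)
      also have "\<dots> = (\<Sum>i\<in>B. \<Sum>k<M. (cmod (win k i * f i))\<^sup>2)" by (rule sum.swap)
      also have "\<dots> = (\<Sum>i\<in>B. N * (cmod (f i))\<^sup>2)"
      proof (rule sum.cong[OF refl])
        fix i assume "i \<in> B"
        then have m: "len i + N \<le> M" using M B by auto
        have "(\<Sum>k<M. (cmod (win k i * f i))\<^sup>2) = (\<Sum>k\<in>{len i..<len i + N}. (cmod (f i))\<^sup>2)"
          by (rule sum.mono_neutral_cong_right) (use m in \<open>auto simp: win_def\<close>)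
        then show "(\<Sum>k<M. (cmod (win k i * f i))\<^sup>2) = N * (cmod (f i))\<^sup>2" by simp
      qed
      finally show ?thesis by (simp add: sum_distrib_left)
    qed
    have win: "(\<Sum>k<M. win k i * win k j) = of_nat (card ({len i..<len i + N} \<inter> {len j..<len j + N}))"
      if "i \<in> F" for i j
    proof -
      have m: "len i + N \<le> M" using M that by auto
      have "(\<Sum>k<M. win k i * win k j) = (\<Sum>k\<in>{len i..<len i + N} \<inter> {len j..<len j + N}. 1)"
        by (rule sum.mono_neutral_cong_right) (use m in \<open>auto simp: win_def\<close>)
      then show ?thesis by simp
    qed
    have cnj_win: "cnj (win k i) = win k i" for k i by (simp add: win_def)
    have cT: "cinner (blinfun_apply T (Q A a k)) (Q F u k) =
        (\<Sum>i\<in>F. \<Sum>j\<in>A. win k i * win k j * (a j * cnj (u i) * coord (blinfun_apply T (basis_vec j)) i))" for k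
    proof -
      have cr: "cinner y (\<Sum>i\<in>F. f i *\<^sub>C basis_vec i) = (\<Sum>i\<in>F. cnj (f i) * coord y i)"
        for y and f :: "'i \<Rightarrow> complex"
        using F
      proof (induction F rule: finite_induct)
        case empty then show ?case by (simp add: cinner_def)
      next
        case (insert i F)
        have "cinner y (p + q) = cinner y p + cinner y q" for p q
          by (metis cinner_add_left cinner_commute complex_cnj_add)
        with insert show ?case by (simp add: cinner_cscale_right)
      qed
      show ?thesis
        unfolding Q_def cr apply_finite_sum[OF T]
        by (simp add: sum_distrib_left cnj_win mult_ac)
    qed
    \<comment> \<open>Pairing \<open>S x\<close> with its own restriction \<open>u\<close> to
      \<open>F\<close> writes \<open>N * s\<close> as a double sum of entries of \<open>S\<close>.
      The hypothesis \<open>avg\<close> trades each entry for a sum over windows, and exchanging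
      sums collects one compression of \<open>T\<close> per window.\<close>
    have "of_nat N * complex_of_real s = (\<Sum>i\<in>F. of_nat N * (u i * cnj (u i)))"
      by (simp add: s_def sum_distrib_left flip: complex_norm_square)
    also have "\<dots> = (\<Sum>i\<in>F. \<Sum>j\<in>A. a j * cnj (u i) * (of_nat N * coord (blinfun_apply S (basis_vec j)) i))"
    proof (rule sum.cong[OF refl])
      fix i
      have "u i = (\<Sum>j\<in>A. a j * coord (blinfun_apply S (basis_vec j)) i)"
        by (simp add: u_def x apply_finite_sum[OF S])
      then have "of_nat N * (u i * cnj (u i)) = of_nat N * ((\<Sum>j\<in>A. a j * coord (blinfun_apply S (basis_vec j)) i) * cnj (u i))"
        by (rule arg_cong)
      then show "of_nat N * (u i * cnj (u i)) = (\<Sum>j\<in>A. a j * cnj (u i) * (of_nat N * coord (blinfun_apply S (basis_vec j)) i))"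
        by (simp add: sum_distrib_left sum_distrib_right mult_ac)
    qed
    also have "\<dots> = (\<Sum>i\<in>F. \<Sum>j\<in>A. (\<Sum>k<M. win k i * win k j) * (a j * cnj (u i) * coord (blinfun_apply T (basis_vec j)) i))"
      by (intro sum.cong refl) (simp only: avg win mult_ac)
    also have "\<dots> = (\<Sum>i\<in>F. \<Sum>k<M. \<Sum>j\<in>A. win k i * win k j * (a j * cnj (u i) * coord (blinfun_apply T (basis_vec j)) i))"
      by (subst (2) sum.swap) (simp only: sum_distrib_right)
    also have "\<dots> = (\<Sum>k<M. cinner (blinfun_apply T (Q A a k)) (Q F u k))"
      unfolding cT by (rule sum.swap)
    finally have eq: "of_nat N * complex_of_real s = (\<Sum>k<M. cinner (blinfun_apply T (Q A a k)) (Q F u k))" .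
    have s0: "s \<ge> 0" by (simp add: s_def sum_nonneg)
    have x2: "(norm x)\<^sup>2 = (\<Sum>i\<in>A. (cmod (a i))\<^sup>2)" unfolding x by (rule norm_basis_sum[OF A])
    have "N * s = cmod (of_nat N * complex_of_real s)" using s0 by (simp add: norm_mult)
    also have "\<dots> \<le> (\<Sum>k<M. norm T * (\<bar>norm (Q A a k)\<bar> * \<bar>norm (Q F u k)\<bar>))"
      unfolding eq
    proof (rule sum_norm_le)
      fix k
      have "cmod (cinner (blinfun_apply T (Q A a k)) (Q F u k)) \<le> norm (blinfun_apply T (Q A a k)) * norm (Q F u k)"
        by (rule cinner_Cauchy_Schwarz)
      also have "\<dots> \<le> (norm T * norm (Q A a k)) * norm (Q F u k)"
        by (intro mult_right_mono norm_blinfun) auto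
      finally show "cmod (cinner (blinfun_apply T (Q A a k)) (Q F u k)) \<le> norm T * (\<bar>norm (Q A a k)\<bar> * \<bar>norm (Q F u k)\<bar>)"
        by (simp add: mult_ac)
    qed
    also have "\<dots> \<le> norm T * (L2_set (\<lambda>k. norm (Q A a k)) {..<M} * L2_set (\<lambda>k. norm (Q F u k)) {..<M})"
      unfolding sum_distrib_left[symmetric] by (intro mult_left_mono L2_set_mult_ineq) auto
    \<comment> \<open>By \<open>Qn\<close> each of the two \<open>L2_set\<close> factors contributes
      \<open>sqrt N\<close>; their product cancels the \<open>N\<close> on the left of the
      chain.\<close>
    also have "\<dots> = N * (norm T * norm x * sqrt s)"
      using A F by (simp add: L2_set_def Qn flip: x2 s_def) (simp add: real_sqrt_mult)
    finally have "s \<le> norm T * norm x * sqrt s" using N by simp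
    then have "sqrt s * sqrt s \<le> (norm T * norm x) * sqrt s" using s0 by simp
    then have "sqrt s \<le> norm T * norm x"
      using s0 mult_right_le_imp_le[of "sqrt s" "sqrt s" "norm T * norm x"] by (cases "s = 0") auto
    then have "s \<le> (norm T * norm x)\<^sup>2" using s0 by (simp add: sqrt_le_D)
    then show "(\<Sum>i\<in>F. (cmod (coord (blinfun_apply S x) i))\<^sup>2) \<le> (norm T * norm x)\<^sup>2"
      by (simp add: s_def u_def)
  qed simp
  fix x :: "'i ell2"
  let ?s = "\<lambda>A. \<Sum>j\<in>A. coord x j *\<^sub>C basis_vec j"
  have lim: "(?s \<longlongrightarrow> x) (finite_subsets_at_top UNIV)"
    using ell2_expansion[of x] by (simp add: has_sum_def)
  show "norm (blinfun_apply S x) \<le> norm T * norm x"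
  proof (rule tendsto_le)
    show "finite_subsets_at_top (UNIV :: 'i set) \<noteq> bot" by simp
    show "((\<lambda>A. norm T * norm (?s A)) \<longlongrightarrow> norm T * norm x) (finite_subsets_at_top UNIV)"
      by (intro tendsto_intros lim)
    show "((\<lambda>A. norm (blinfun_apply S (?s A))) \<longlongrightarrow> norm (blinfun_apply S x)) (finite_subsets_at_top UNIV)"
      by (intro tendsto_intros lim)
    show "\<forall>\<^sub>F A in finite_subsets_at_top UNIV. norm (blinfun_apply S (?s A)) \<le> norm T * norm (?s A)"
      by (rule eventually_finite_subsets_at_top_weakI) (rule fin, auto)
  qed
qed

lemma has_sum_sum:
  fixes f :: "'a \<Rightarrow> 'b \<Rightarrow> 'c::topological_comm_monoid_add"
  assumes "finite I" "\<And>i. i \<in> I \<Longrightarrow> (f i has_sum s i) A"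
  shows "((\<lambda>x. \<Sum>i\<in>I. f i x) has_sum (\<Sum>i\<in>I. s i)) A"
  using assms by (induction I rule: finite_induct) (simp_all add: has_sum_add)

section \<open>Hilbert-Schmidt operators and the trace\<close>

lemma coord_adjoint:
  assumes T: "T \<in> bounded_ops"
  shows "coord (adjoint (blinfun_apply T) (basis_vec i)) j = cnj (coord (blinfun_apply T (basis_vec j)) i)"
    (is "coord ?r j = _")
proof -
  \<comment> \<open>\<open>inner\<close> sees only real parts; the choices \<open>c = 1\<close> and
    \<open>c = \<i>\<close> recover both parts of the complex entry.\<close>
  have "Re (c * cnj (coord ?r j)) = Re (c * coord (blinfun_apply T (basis_vec j)) i)" for c
  proof -
    have "inner (c *\<^sub>C basis_vec j) ?r = Re (c * cnj (coord ?r j))"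
      unfolding inner_ell2_def cinner_cscale_left by (subst cinner_commute) simp
    moreover have "inner (blinfun_apply T (c *\<^sub>C basis_vec j)) (basis_vec i)
        = Re (c * coord (blinfun_apply T (basis_vec j)) i)"
      by (simp add: bounded_opsD[OF T] inner_ell2_def)
    ultimately show ?thesis using adjoint_op[OF T, of "c *\<^sub>C basis_vec j" "basis_vec i"] by simp
  qed
  from this[of 1] this[of \<i>] show ?thesis by (simp add: complex_eq_iff)
qed

lemma coord_apply_le_adjoint:
  assumes T: "T \<in> bounded_ops"
  shows "cmod (coord (blinfun_apply T x) i) \<le> norm x * norm (adjoint (blinfun_apply T) (basis_vec i))"
proof -
  define z where "z = coord (blinfun_apply T x) i"
  \<comment> \<open>This phase rotates \<open>z\<close> onto the nonnegative reals, where the real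
    inner product already gives the modulus. If \<open>z = 0\<close>, then \<open>c = 0\<close>,
    which is harmless.\<close>
  define c where "c = cnj (sgn z)"
  have "c * z = of_real (cmod z)"
    unfolding c_def sgn_eq
    by (simp add: divide_simps complex_norm_square[symmetric] power2_eq_square mult.commute[of "cnj _"])
  then have "cmod z = inner (blinfun_apply T (c *\<^sub>C x)) (basis_vec i)"
    by (simp add: inner_ell2_def bounded_opsD[OF T] flip: z_def)
  also have "\<dots> = inner (c *\<^sub>C x) (adjoint (blinfun_apply T) (basis_vec i))" by (rule adjoint_op[OF T])
  also have "\<dots> \<le> norm (c *\<^sub>C x) * norm (adjoint (blinfun_apply T) (basis_vec i))"
    by (rule norm_cauchy_schwarz)
  also have "\<dots> \<le> norm x * norm (adjoint (blinfun_apply T) (basis_vec i))"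
    by (intro mult_right_mono) (auto simp: c_def norm_sgn)
  finally show ?thesis by (simp add: z_def)
qed

text \<open>Both sides add squared moduli of entries of \<open>B\<close>: the left over the rows in
  \<open>F\<close>, the right over all columns.\<close>

lemma hilbert_schmidt_adjoint_sum_le:
  assumes B: "hilbert_schmidt B" and F: "finite F"
  shows "(\<Sum>i\<in>F. (norm (adjoint (blinfun_apply B) (basis_vec i)))\<^sup>2)
    \<le> (\<Sum>\<^sub>\<infinity>j. (norm (blinfun_apply B (basis_vec j)))\<^sup>2)"
proof -
  have Bo: "B \<in> bounded_ops" and sm: "(\<lambda>j. (norm (blinfun_apply B (basis_vec j)))\<^sup>2) summable_on UNIV"
    using B by (auto simp: hilbert_schmidt_def)
  let ?f = "\<lambda>i j. (cmod (coord (blinfun_apply B (basis_vec j)) i))\<^sup>2"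
  have "((\<lambda>j. (cmod (coord (adjoint (blinfun_apply B) (basis_vec i)) j))\<^sup>2) has_sum
      (norm (adjoint (blinfun_apply B) (basis_vec i)))\<^sup>2) UNIV" for i
    unfolding norm_ell2_square by (simp add: coord_summable)
  then have "(?f i has_sum (norm (adjoint (blinfun_apply B) (basis_vec i)))\<^sup>2) UNIV" for i
    by (simp add: coord_adjoint[OF Bo])
  then have "((\<lambda>j. \<Sum>i\<in>F. ?f i j) has_sum (\<Sum>i\<in>F. (norm (adjoint (blinfun_apply B) (basis_vec i)))\<^sup>2)) UNIV"
    by (intro has_sum_sum F)
  moreover have "((\<lambda>j. (norm (blinfun_apply B (basis_vec j)))\<^sup>2) has_sum
      (\<Sum>\<^sub>\<infinity>j. (norm (blinfun_apply B (basis_vec j)))\<^sup>2)) UNIV"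
    using sm by simp
  ultimately show ?thesis
    by (rule has_sum_mono) (rule sum_coord_le_norm[OF F])
qed

lemma hilbert_schmidt_compose_left:
  assumes T: "T \<in> bounded_ops" and B: "hilbert_schmidt B"
  shows "hilbert_schmidt (T o\<^sub>L B)"
    and "(\<Sum>\<^sub>\<infinity>j. (norm (blinfun_apply (T o\<^sub>L B) (basis_vec j)))\<^sup>2)
      \<le> (norm T)\<^sup>2 * (\<Sum>\<^sub>\<infinity>j. (norm (blinfun_apply B (basis_vec j)))\<^sup>2)"
proof -
  have Bo: "B \<in> bounded_ops" and sm: "(\<lambda>j. (norm (blinfun_apply B (basis_vec j)))\<^sup>2) summable_on UNIV"
    using B by (auto simp: hilbert_schmidt_def)
  have le: "(norm (blinfun_apply (T o\<^sub>L B) (basis_vec j)))\<^sup>2 \<le> (norm T)\<^sup>2 * (norm (blinfun_apply B (basis_vec j)))\<^sup>2" for j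
    by (simp add: norm_blinfun power_mono flip: power_mult_distrib)
  have sm2: "(\<lambda>j. (norm T)\<^sup>2 * (norm (blinfun_apply B (basis_vec j)))\<^sup>2) summable_on UNIV"
    by (rule summable_on_cmult_right[OF sm])
  have sm1: "(\<lambda>j. (norm (blinfun_apply (T o\<^sub>L B) (basis_vec j)))\<^sup>2) summable_on UNIV"
    by (rule summable_on_comparison_test[OF sm2]) (use le in auto)
  then show "hilbert_schmidt (T o\<^sub>L B)"
    using T Bo by (simp add: hilbert_schmidt_def bounded_ops_compose)
  have "(\<Sum>\<^sub>\<infinity>j. (norm (blinfun_apply (T o\<^sub>L B) (basis_vec j)))\<^sup>2)
      \<le> (\<Sum>\<^sub>\<infinity>j. (norm T)\<^sup>2 * (norm (blinfun_apply B (basis_vec j)))\<^sup>2)"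
    by (rule infsum_mono[OF sm1 sm2 le])
  then show "(\<Sum>\<^sub>\<infinity>j. (norm (blinfun_apply (T o\<^sub>L B) (basis_vec j)))\<^sup>2)
      \<le> (norm T)\<^sup>2 * (\<Sum>\<^sub>\<infinity>j. (norm (blinfun_apply B (basis_vec j)))\<^sup>2)"
    by (simp add: infsum_cmult_right')
qed

text \<open>The \<open>i\<close>-th term pairs \<open>x i\<close> with the adjoint of
  \<open>T o\<^sub>L B\<close> at \<open>basis_vec i\<close>, and Cauchy-Schwarz over
  \<open>G\<close> separates the two. With \<open>x i\<close> the image of
  \<open>basis_vec i\<close> under \<open>C\<close>, this bounds any finite piece of a trace by the
  corresponding piece of \<open>C\<close>.\<close>

lemma trace_partial_sum_le:
  assumes T: "T \<in> bounded_ops" and B: "hilbert_schmidt B" and G: "finite G"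
  shows "(\<Sum>i\<in>G. cmod (coord (blinfun_apply (T o\<^sub>L B) (x i)) i))
    \<le> norm T * sqrt (\<Sum>\<^sub>\<infinity>j. (norm (blinfun_apply B (basis_vec j)))\<^sup>2) * L2_set (\<lambda>i. norm (x i)) G"
proof -
  let ?TB = "T o\<^sub>L B"
  let ?h = "\<Sum>\<^sub>\<infinity>j. (norm (blinfun_apply B (basis_vec j)))\<^sup>2"
  have TB: "?TB \<in> bounded_ops" using hilbert_schmidt_compose_left(1)[OF T B] by (simp add: hilbert_schmidt_def)
  have "(\<Sum>i\<in>G. cmod (coord (blinfun_apply ?TB (x i)) i))
      \<le> (\<Sum>i\<in>G. \<bar>norm (x i)\<bar> * \<bar>norm (adjoint (blinfun_apply ?TB) (basis_vec i))\<bar>)"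
    by (intro sum_mono) (use coord_apply_le_adjoint[OF TB] in simp)
  also have "\<dots> \<le> L2_set (\<lambda>i. norm (x i)) G * L2_set (\<lambda>i. norm (adjoint (blinfun_apply ?TB) (basis_vec i))) G"
    by (rule L2_set_mult_ineq)
  also have "\<dots> \<le> L2_set (\<lambda>i. norm (x i)) G * (norm T * sqrt ?h)"
  proof (rule mult_left_mono)
    have "(\<Sum>i\<in>G. (norm (adjoint (blinfun_apply ?TB) (basis_vec i)))\<^sup>2) \<le> (norm T)\<^sup>2 * ?h"
      using hilbert_schmidt_adjoint_sum_le[OF hilbert_schmidt_compose_left(1)[OF T B] G]
        hilbert_schmidt_compose_left(2)[OF T B] by linarith
    then have "L2_set (\<lambda>i. norm (adjoint (blinfun_apply ?TB) (basis_vec i))) G \<le> sqrt ((norm T)\<^sup>2 * ?h)"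
      unfolding L2_set_def by (rule real_sqrt_le_mono)
    then show "L2_set (\<lambda>i. norm (adjoint (blinfun_apply ?TB) (basis_vec i))) G \<le> norm T * sqrt ?h"
      by (simp add: real_sqrt_mult)
  qed simp
  finally show ?thesis by (simp add: mult_ac)
qed

lemma summable_on_small_tail:
  fixes f :: "'a \<Rightarrow> real"
  assumes f: "f summable_on UNIV" "\<And>i. f i \<ge> 0" and e: "e > 0"
  obtains F where "finite F" "\<And>G. finite G \<Longrightarrow> G \<inter> F = {} \<Longrightarrow> sum f G \<le> e"
proof -
  have "(sum f \<longlongrightarrow> infsum f UNIV) (finite_subsets_at_top UNIV)"
    using f(1) by (simp add: has_sum_infsum flip: has_sum_def)
  then have "\<forall>\<^sub>F F in finite_subsets_at_top UNIV. dist (sum f F) (infsum f UNIV) < e"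
    using e by (simp add: tendsto_iff)
  then obtain F where F: "finite F" "dist (sum f F) (infsum f UNIV) < e"
    by (auto simp: eventually_finite_subsets_at_top)
  show ?thesis
  proof (rule that[OF F(1)])
    fix G assume G: "finite G" "G \<inter> F = {}"
    have "sum f (G \<union> F) \<le> infsum f UNIV"
      by (rule finite_sum_le_infsum) (use f F G in auto)
    then show "sum f G \<le> e"
      using F G by (simp add: sum.union_disjoint dist_real_def)
  qed
qed

text \<open>This makes \<open>op_trace\<close> a genuine sum on these products rather than the
  default value 0 of a divergent \<open>infsum\<close>.\<close>

lemma op_trace_abs_summable:
  assumes T: "T \<in> bounded_ops" and B: "hilbert_schmidt B" and C: "hilbert_schmidt C"
  shows "(\<lambda>i. cmod (coord (blinfun_apply (T o\<^sub>L (B o\<^sub>L C)) (basis_vec i)) i)) summable_on UNIV"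
proof (rule nonneg_bdd_above_summable_on)
  let ?h = "\<lambda>B. \<Sum>\<^sub>\<infinity>j. (norm (blinfun_apply B (basis_vec j)))\<^sup>2"
  have sm: "(\<lambda>i. (norm (blinfun_apply C (basis_vec i)))\<^sup>2) summable_on UNIV"
    using C by (simp add: hilbert_schmidt_def)
  show "bdd_above (sum (\<lambda>i. cmod (coord (blinfun_apply (T o\<^sub>L (B o\<^sub>L C)) (basis_vec i)) i)) ` {F. F \<subseteq> UNIV \<and> finite F})"
  proof (rule bdd_aboveI2)
    fix G :: "'a set" assume "G \<in> {F. F \<subseteq> UNIV \<and> finite F}"
    then have G: "finite G" by simp
    have "L2_set (\<lambda>i. norm (blinfun_apply C (basis_vec i))) G \<le> sqrt (?h C)"
      unfolding L2_set_def by (intro real_sqrt_le_mono finite_sum_le_infsum) (use sm G in auto)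
    then have "norm T * sqrt (?h B) * L2_set (\<lambda>i. norm (blinfun_apply C (basis_vec i))) G
        \<le> norm T * sqrt (?h B) * sqrt (?h C)"
      by (intro mult_left_mono) (auto simp: infsum_nonneg)
    with trace_partial_sum_le[OF T B G, of "\<lambda>i. blinfun_apply C (basis_vec i)"]
    show "(\<Sum>i\<in>G. cmod (coord (blinfun_apply (T o\<^sub>L (B o\<^sub>L C)) (basis_vec i)) i))
        \<le> norm T * sqrt (?h B) * sqrt (?h C)" by simp
  qed
qed auto

text \<open>The tail of the trace is controlled by the factor \<open>C\<close> alone, hence
  uniformly in \<open>n\<close>; the remaining finitely many diagonal entries vanish by strong
  convergence.\<close>

lemma op_trace_tendsto_zero:
  fixes D :: "nat \<Rightarrow> 'i ell2_op"
  assumes D: "\<And>n. D n \<in> bounded_ops" and K: "\<And>n. norm (D n) \<le> K"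
    and lim: "\<And>x. (\<lambda>n. blinfun_apply (D n) x) \<longlonglongrightarrow> 0" and A: "trace_class A"
  shows "(\<lambda>n. op_trace (D n o\<^sub>L A)) \<longlonglongrightarrow> 0"
proof (rule LIMSEQ_I)
  fix e :: real assume e: "e > 0"
  obtain B C where B: "hilbert_schmidt B" and C: "hilbert_schmidt C" and A: "A = B o\<^sub>L C"
    using A unfolding trace_class_def by blast
  let ?h = "\<Sum>\<^sub>\<infinity>j. (norm (blinfun_apply B (basis_vec j)))\<^sup>2"
  \<comment> \<open>\<open>L\<close> dominates \<open>norm (D n)\<close> times the Hilbert-Schmidt
    norm of \<open>B\<close> for every \<open>n\<close>; the summand 1 permits division by
    \<open>L\<close>.\<close>
  define L where "L = K * sqrt ?h + 1"
  have K0: "K \<ge> 0" using K[of 0] norm_ge_zero[of "D 0"] by linarith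
  then have L: "L > 0" by (simp add: L_def infsum_nonneg add_nonneg_pos)
  define f where "f n i = coord (blinfun_apply (D n o\<^sub>L A) (basis_vec i)) i" for n i
  have fsum: "(\<lambda>i. cmod (f n i)) summable_on S" for n S
    using op_trace_abs_summable[OF D B C, of n] unfolding f_def A by (rule summable_on_subset_banach) auto
  obtain F where F: "finite F"
    and tail: "\<And>G. finite G \<Longrightarrow> G \<inter> F = {} \<Longrightarrow> (\<Sum>i\<in>G. (norm (blinfun_apply C (basis_vec i)))\<^sup>2) \<le> (e/2/L)\<^sup>2"
    using summable_on_small_tail[of "\<lambda>i. (norm (blinfun_apply C (basis_vec i)))\<^sup>2" "(e/2/L)\<^sup>2"] C e L
    by (auto simp: hilbert_schmidt_def)
  have "(\<lambda>n. f n i) \<longlonglongrightarrow> 0" for i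
    unfolding f_def using bounded_linear.tendsto_zero[OF bounded_linear_coord lim] by simp
  then have "(\<lambda>n. \<Sum>i\<in>F. cmod (f n i)) \<longlonglongrightarrow> (\<Sum>i\<in>F. 0)"
    by (intro tendsto_sum tendsto_norm_zero)
  then obtain N where N: "\<And>n. n \<ge> N \<Longrightarrow> (\<Sum>i\<in>F. cmod (f n i)) < e/2"
    using LIMSEQ_D[of _ 0 "e/2"] e by (fastforce simp: sum_nonneg)
  have "norm (op_trace (D n o\<^sub>L A)) < e" if n: "n \<ge> N" for n
  proof -
    have "op_trace (D n o\<^sub>L A) = infsum (f n) UNIV" unfolding op_trace_def f_def by simp
    also have "cmod \<dots> \<le> (\<Sum>\<^sub>\<infinity>i. cmod (f n i))" by (rule norm_infsum_bound[OF fsum])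
    also have "\<dots> = (\<Sum>\<^sub>\<infinity>i\<in>F \<union> - F. cmod (f n i))" by simp
    also have "\<dots> = (\<Sum>i\<in>F. cmod (f n i)) + (\<Sum>\<^sub>\<infinity>i\<in>-F. cmod (f n i))"
      using F by (subst infsum_Un_disjoint) (auto simp: fsum)
    finally have "norm (op_trace (D n o\<^sub>L A)) \<le> (\<Sum>i\<in>F. cmod (f n i)) + (\<Sum>\<^sub>\<infinity>i\<in>-F. cmod (f n i))" .
    moreover have "(\<Sum>\<^sub>\<infinity>i\<in>-F. cmod (f n i)) \<le> e/2"
    proof (rule infsum_le_finite_sums[OF fsum])
      fix G assume G: "finite G" "G \<subseteq> - F"
      have "L2_set (\<lambda>i. norm (blinfun_apply C (basis_vec i))) G \<le> e/2/L"
        unfolding L2_set_def by (rule real_le_lsqrt) (use tail[of G] G e L in \<open>auto simp: sum_nonneg\<close>)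
      moreover have "norm (D n) * sqrt ?h \<le> L"
        using mult_right_mono[OF K[of n], of "sqrt ?h"] by (simp add: L_def infsum_nonneg)
      ultimately have "norm (D n) * sqrt ?h * L2_set (\<lambda>i. norm (blinfun_apply C (basis_vec i))) G \<le> L * (e/2/L)"
        using L by (intro mult_mono) auto
      then show "(\<Sum>i\<in>G. cmod (f n i)) \<le> e/2"
        using trace_partial_sum_le[OF D B G(1), of n "\<lambda>i. blinfun_apply C (basis_vec i)"] L
        by (simp add: f_def A)
    qed
    ultimately show ?thesis using N[OF n] by linarith
  qed
  then show "\<exists>N. \<forall>n\<ge>N. norm (op_trace (D n o\<^sub>L A) - 0) < e" by auto
qed

lemma op_trace_diff:
  assumes "S \<in> bounded_ops" "T \<in> bounded_ops" "trace_class A"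
  shows "op_trace ((S - T) o\<^sub>L A) = op_trace (S o\<^sub>L A) - op_trace (T o\<^sub>L A)"
proof -
  obtain B C where B: "hilbert_schmidt B" and C: "hilbert_schmidt C" and A: "A = B o\<^sub>L C"
    using assms(3) unfolding trace_class_def by blast
  have "(\<lambda>i. coord (blinfun_apply (S o\<^sub>L A) (basis_vec i)) i) summable_on UNIV"
    if "S \<in> bounded_ops" for S
    unfolding A by (rule abs_summable_summable[OF op_trace_abs_summable[OF that B C]])
  then have tr: "((\<lambda>i. coord (blinfun_apply (S o\<^sub>L A) (basis_vec i)) i) has_sum op_trace (S o\<^sub>L A)) UNIV"
    if "S \<in> bounded_ops" for S
    unfolding op_trace_def cinner_basis_right using that by (intro has_sum_infsum) blast
  have "((\<lambda>i. coord (blinfun_apply (S o\<^sub>L A) (basis_vec i)) i + - coord (blinfun_apply (T o\<^sub>L A) (basis_vec i)) i)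
      has_sum (op_trace (S o\<^sub>L A) + - op_trace (T o\<^sub>L A))) UNIV"
    by (intro has_sum_add tr assms) (simp only: has_sum_uminus minus_minus tr assms)
  then show ?thesis unfolding op_trace_def[of "(S - T) o\<^sub>L A"]
    by (intro infsumI) (simp add: blinfun.diff_left)
qed

text \<open>Matrix entries are traces against matrix units, which is why they are weak-star
  continuous.\<close>

lemma trace_class_rank_one:
  obtains A :: "'i ell2_op" where "trace_class A"
    and "\<And>T. op_trace (T o\<^sub>L A) = coord (blinfun_apply T (basis_vec j)) i"
proof -
  obtain A :: "'i \<Rightarrow> 'i ell2_op" where A: "\<And>k. A k \<in> bounded_ops"
    and Ab: "\<And>k l. blinfun_apply (A k) (basis_vec l) = (if l = k then basis_vec j else 0)"
  proof -
    have "\<exists>T. T \<in> bounded_ops \<and> (\<forall>l. blinfun_apply T (basis_vec l) = (if l = k then basis_vec j else 0))" for k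
      by (rule weighted_shift[of "\<lambda>_. j" "{k}" "\<lambda>_. 1" 1]) auto
    then show ?thesis using that by metis
  qed
  have HS: "hilbert_schmidt (A k)" for k
  proof -
    have "(\<lambda>l. (norm (blinfun_apply (A k) (basis_vec l)))\<^sup>2) summable_on UNIV \<longleftrightarrow>
        (\<lambda>l. (norm (blinfun_apply (A k) (basis_vec l)))\<^sup>2) summable_on {k}"
      by (rule summable_on_cong_neutral) (auto simp: Ab)
    then show ?thesis by (simp add: hilbert_schmidt_def A)
  qed
  \<comment> \<open>\<open>A j\<close> is the projection onto the line of
    \<open>basis_vec j\<close>, which contains the range of \<open>A i\<close>; this exhibits
    \<open>A i\<close> as a product of two Hilbert-Schmidt operators.\<close>
  have "A i = A j o\<^sub>L A i"
    by (rule bounded_ops_eqI) (auto simp: A bounded_ops_compose Ab)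
  with HS have tc: "trace_class (A i)" unfolding trace_class_def by blast
  show ?thesis
  proof (rule that[OF tc])
    fix T :: "'i ell2_op"
    have "op_trace (T o\<^sub>L A i) = (\<Sum>\<^sub>\<infinity>l\<in>{i}. coord (blinfun_apply (T o\<^sub>L A i) (basis_vec l)) l)"
      unfolding op_trace_def by (rule infsum_cong_neutral) (auto simp: Ab)
    then show "op_trace (T o\<^sub>L A i) = coord (blinfun_apply T (basis_vec j)) i" by (simp add: Ab)
  qed
qed

section \<open>Topologies with continuous matrix entries\<close>

lemma limitin_pullback_topologyI:
  assumes "limitin Y (\<lambda>n. f (s n)) (f l) F" "l \<in> A" "\<And>n. s n \<in> A"
  shows "limitin (pullback_topology A f Y) s l F"
  unfolding limitin_def
proof (intro conjI allI impI)
  show "l \<in> topspace (pullback_topology A f Y)"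
    using assms limitin_topspace[OF assms(1)] by (auto simp: topspace_pullback_topology)
  fix U assume "openin (pullback_topology A f Y) U \<and> l \<in> U"
  then obtain V where V: "openin Y V" "U = f -` V \<inter> A" "f l \<in> V"
    by (auto simp: openin_pullback_topology)
  then have "\<forall>\<^sub>F n in F. f (s n) \<in> V" using assms(1) by (auto simp: limitin_def)
  then show "\<forall>\<^sub>F n in F. s n \<in> U" by eventually_elim (use V assms in auto)
qed

text \<open>The Euclidean topology on functions is the product topology, so strong and weak operator
  limits reduce to pointwise ones.\<close>

lemma tendsto_funI:
  fixes f :: "'a \<Rightarrow> 'b \<Rightarrow> 'c::topological_space"
  assumes "\<And>x. ((\<lambda>n. f n x) \<longlongrightarrow> l x) F"
  shows "(f \<longlongrightarrow> l) F"
proof -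
  have "limitin (product_topology (\<lambda>_. euclidean) UNIV) f l F"
    unfolding limitin_componentwise using assms by simp
  then show ?thesis by (simp add: euclidean_product_topology)
qed

text \<open>The common interface of the three operator topologies: continuous entries make the Hardy
  algebra closed, and bounded strong convergence brings the Cesaro means into the closure. The bound
  \<open>K\<close> controls the tails of traces in the weak-star case.\<close>

locale coordinate_topology =
  fixes \<tau> :: "'i ell2_op topology"
  assumes topspace_eq: "topspace \<tau> = bounded_ops"
    and continuous_coord: "continuous_map \<tau> euclidean (\<lambda>T. coord (blinfun_apply T (basis_vec j)) i)"
    and limitin_bounded: "\<lbrakk>\<And>n. s n \<in> bounded_ops; T \<in> bounded_ops; \<And>n. norm (s n) \<le> K;
      \<And>x. (\<lambda>n. blinfun_apply (s n) x) \<longlonglongrightarrow> blinfun_apply T x\<rbrakk> \<Longrightarrow> limitin \<tau> s T sequentially"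

lemma SOT_coordinate: "coordinate_topology SOT"
proof
  show "topspace SOT = bounded_ops"
    by (simp add: SOT_def strong_operator_topology_topspace)
  have "continuous_map SOT euclidean (\<lambda>T. blinfun_apply T (basis_vec j))" for j
    unfolding SOT_def
    by (rule continuous_map_from_subtopology) (rule strong_operator_topology_continuous_evaluation)
  from continuous_map_compose[OF this, of euclidean "\<lambda>x. coord x i" for i]
  show "continuous_map SOT euclidean (\<lambda>T. coord (blinfun_apply T (basis_vec j)) i)" for i j
    by (simp add: o_def linear_continuous_on[OF bounded_linear_coord])
  show "limitin SOT s T sequentially"
    if "\<And>n. s n \<in> bounded_ops" "T \<in> bounded_ops" "\<And>x. (\<lambda>n. blinfun_apply (s n) x) \<longlonglongrightarrow> blinfun_apply T x" for s T
    unfolding SOT_def limitin_subtopology strong_operator_topology_def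
    using that by (auto intro!: limitin_pullback_topologyI tendsto_funI)
qed

lemma WOT_coordinate: "coordinate_topology WOT"
proof
  show "topspace WOT = bounded_ops"
    by (simp add: WOT_def topspace_pullback_topology)
  have "continuous_map WOT euclidean ((\<lambda>g. g (basis_vec j) (basis_vec i)) \<circ> (\<lambda>T. \<lambda>x y. cinner (blinfun_apply T x) y))" for i j
    unfolding WOT_def
    by (intro continuous_map_pullback)
      (simp add: continuous_on_product_then_coordinatewise[OF continuous_on_product_coordinates])
  then show "continuous_map WOT euclidean (\<lambda>T. coord (blinfun_apply T (basis_vec j)) i)" for i j
    by (simp add: o_def)
  show "limitin WOT s T sequentially"
    if "\<And>n. s n \<in> bounded_ops" "T \<in> bounded_ops" "\<And>x. (\<lambda>n. blinfun_apply (s n) x) \<longlonglongrightarrow> blinfun_apply T x" for s T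
    unfolding WOT_def
  proof (rule limitin_pullback_topologyI)
    show "limitin euclidean (\<lambda>n x y. cinner (blinfun_apply (s n) x) y) (\<lambda>x y. cinner (blinfun_apply T x) y) sequentially"
      unfolding limitin_canonical_iff
      by (intro tendsto_funI bounded_linear.tendsto[OF bounded_linear_cinner_left] that)
  qed (use that in auto)
qed

lemma weak_star_coordinate: "coordinate_topology weak_star_topology"
proof
  let ?P = "product_topology (\<lambda>_. euclidean :: complex topology) {A :: 'a ell2_op. trace_class A}"
  let ?f = "\<lambda>T. \<lambda>A\<in>{A :: 'a ell2_op. trace_class A}. op_trace (T o\<^sub>L A)"
  show "topspace weak_star_topology = (bounded_ops :: 'a ell2_op set)"
    by (auto simp: weak_star_topology_def topspace_pullback_topology)
  show "continuous_map weak_star_topology euclidean (\<lambda>T. coord (blinfun_apply T (basis_vec j)) i)" for i j :: 'a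
  proof -
    obtain A :: "'a ell2_op" where A: "trace_class A"
      and tr: "\<And>T. op_trace (T o\<^sub>L A) = coord (blinfun_apply T (basis_vec j)) i"
      using trace_class_rank_one[of j i] by blast
    have "continuous_map weak_star_topology euclidean ((\<lambda>g. g A) \<circ> ?f)"
      unfolding weak_star_topology_def
      by (rule continuous_map_pullback, rule continuous_map_product_projection) (simp add: A)
    then show ?thesis by (simp add: o_def A tr)
  qed
  show "limitin weak_star_topology s T sequentially"
    if s: "\<And>n. s n \<in> bounded_ops" "T \<in> bounded_ops" and K: "\<And>n. norm (s n) \<le> K"
      and lim: "\<And>x. (\<lambda>n. blinfun_apply (s n) x) \<longlonglongrightarrow> blinfun_apply T x"
    for s and T :: "'a ell2_op" and K
    unfolding weak_star_topology_def
  proof (rule limitin_pullback_topologyI)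
    have "(\<lambda>n. op_trace (s n o\<^sub>L A)) \<longlonglongrightarrow> op_trace (T o\<^sub>L A)" if A: "trace_class A" for A
    proof -
      have "norm (s n - T) \<le> K + norm T" for n
        using norm_triangle_ineq4[of "s n" T] K[of n] by linarith
      moreover have "(\<lambda>n. blinfun_apply (s n - T) x) \<longlonglongrightarrow> 0" for x
        using LIM_zero[OF lim] by (simp add: blinfun.diff_left)
      ultimately have "(\<lambda>n. op_trace ((s n - T) o\<^sub>L A)) \<longlonglongrightarrow> 0"
        by (intro op_trace_tendsto_zero A bounded_ops_diff s)
      then show ?thesis by (simp add: op_trace_diff s A LIM_zero_iff)
    qed
    then show "limitin ?P (\<lambda>n. ?f (s n)) (?f T) sequentially"
      by (simp add: limitin_componentwise)
  qed (use s in auto)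
qed

section \<open>Matrices of the elements of the Hardy algebra\<close>

text \<open>The quotients picked up letter by letter telescope, so this one square root is the
  factor with which \<open>W \<beta>\<close> sends \<open>basis_vec \<gamma>\<close> to
  \<open>basis_vec (\<beta> @ \<gamma>)\<close>.\<close>

definition word_weight :: "('n list \<Rightarrow> real) \<Rightarrow> 'n list \<Rightarrow> 'n list \<Rightarrow> real" where
  "word_weight b \<beta> \<gamma> = sqrt (b \<gamma> / b (\<beta> @ \<gamma>))"

text \<open>\<open>T\<close> has the matrix of the formal series \<open>\<Sum> c\<^sub>\<beta> W\<^sub>\<beta>\<close>.\<close>

definition has_symbol :: "('n list \<Rightarrow> real) \<Rightarrow> 'n list ell2_op \<Rightarrow> ('n list \<Rightarrow> complex) \<Rightarrow> bool" where
  "has_symbol b T c \<longleftrightarrow>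
    (\<forall>\<beta> \<gamma>. coord (blinfun_apply T (basis_vec \<gamma>)) (\<beta> @ \<gamma>) = c \<beta> * of_real (word_weight b \<beta> \<gamma>)) \<and>
    (\<forall>\<gamma> \<alpha>. \<alpha> \<notin> range (\<lambda>\<beta>. \<beta> @ \<gamma>) \<longrightarrow> coord (blinfun_apply T (basis_vec \<gamma>)) \<alpha> = 0)"

text \<open>Under these conditions the definite description in \<open>weighted_creation\<close> is
  proper.\<close>

locale fock_weight =
  fixes b :: "'n::finite list \<Rightarrow> real"
  assumes pos: "b \<alpha> > 0"
    and bdd: "bdd_above (range (\<lambda>\<alpha>. b \<alpha> / b (i # \<alpha>)))"
begin

abbreviation W :: "'n list \<Rightarrow> 'n list ell2_op" where
  "W \<equiv> op_word (weighted_creation b)"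

lemma W_bounded: "W \<beta> \<in> bounded_ops"
  by (rule op_word_bounded) (auto intro: weighted_creation(1) pos bdd)

lemma W_basis: "blinfun_apply (W \<beta>) (basis_vec \<gamma>) = of_real (word_weight b \<beta> \<gamma>) *\<^sub>C basis_vec (\<beta> @ \<gamma>)"
proof (induction \<beta>)
  case Nil
  then show ?case using pos[of \<gamma>] by (simp add: word_weight_def)
next
  case (Cons i \<beta>)
  have "word_weight b \<beta> \<gamma> * sqrt (b (\<beta> @ \<gamma>) / b (i # \<beta> @ \<gamma>)) = word_weight b (i # \<beta>) \<gamma>"
    using pos[of "\<beta> @ \<gamma>"] by (simp add: word_weight_def flip: real_sqrt_mult)
  with Cons show ?case
    by (simp add: bounded_opsD[OF weighted_creation(1)[OF pos bdd]] weighted_creation(2)[OF pos bdd]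
        flip: of_real_mult)
qed

lemma word_weight_pos: "word_weight b \<beta> \<gamma> > 0"
  using pos[of \<gamma>] pos[of "\<beta> @ \<gamma>"] by (simp add: word_weight_def)

section \<open>Formal series and their symbols\<close>

lemma inj_append_right: "inj (\<lambda>\<beta>. \<beta> @ \<gamma>)"
  by (auto simp: inj_on_def)

text \<open>Right cancellation of words leaves at most one nonzero term of the series in each
  coordinate \<open>\<alpha>\<close>, namely the one with
  \<open>\<alpha> = \<beta> @ \<gamma>\<close>.\<close>

lemma has_symbolI_series:
  assumes "\<And>\<gamma>. ((\<lambda>\<beta>. c \<beta> *\<^sub>C blinfun_apply (W \<beta>) (basis_vec \<gamma>)) has_sum blinfun_apply T (basis_vec \<gamma>)) UNIV"
  shows "has_symbol b T c"
proof -
  have co: "((\<lambda>\<beta>. if \<alpha> = \<beta> @ \<gamma> then c \<beta> * of_real (word_weight b \<beta> \<gamma>) else 0)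
      has_sum coord (blinfun_apply T (basis_vec \<gamma>)) \<alpha>) UNIV" (is "(?f \<alpha> \<gamma> has_sum _) UNIV") for \<alpha> \<gamma>
    using has_sum_bounded_linear[OF bounded_linear_coord assms, of \<gamma> \<alpha>]
    by (simp add: W_basis if_distrib[of "\<lambda>t. _ * t"] cong: if_cong)
  show ?thesis
    unfolding has_symbol_def
  proof (intro conjI allI impI)
    fix \<beta> \<gamma>
    have "(?f (\<beta> @ \<gamma>) \<gamma> has_sum c \<beta> * of_real (word_weight b \<beta> \<gamma>)) UNIV \<longleftrightarrow>
        (?f (\<beta> @ \<gamma>) \<gamma> has_sum c \<beta> * of_real (word_weight b \<beta> \<gamma>)) {\<beta>}"
      by (rule has_sum_cong_neutral) auto
    then have "(?f (\<beta> @ \<gamma>) \<gamma> has_sum c \<beta> * of_real (word_weight b \<beta> \<gamma>)) UNIV"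
      by (simp add: has_sum_finiteI)
    with co show "coord (blinfun_apply T (basis_vec \<gamma>)) (\<beta> @ \<gamma>) = c \<beta> * of_real (word_weight b \<beta> \<gamma>)"
      by (rule has_sum_unique)
  next
    fix \<gamma> \<alpha> :: "'n list" assume "\<alpha> \<notin> range (\<lambda>\<beta>. \<beta> @ \<gamma>)"
    then have "?f \<alpha> \<gamma> = (\<lambda>_. 0)" by (auto simp: fun_eq_iff)
    with co[of \<alpha> \<gamma>] show "coord (blinfun_apply T (basis_vec \<gamma>)) \<alpha> = 0"
      using has_sum_unique has_sum_0_simp by metis
  qed
qed

text \<open>The symbol confines column \<open>\<gamma>\<close> of \<open>T\<close> to words ending
  in \<open>\<gamma>\<close>. Its basis expansion, reindexed by the prefix \<open>\<beta>\<close>,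
  is the series at \<open>basis_vec \<gamma>\<close>; linearity gives polynomials.\<close>

lemma has_symbol_series:
  assumes T: "T \<in> bounded_ops" and c: "has_symbol b T c" and p: "p \<in> fock_polynomials"
  shows "((\<lambda>\<beta>. c \<beta> *\<^sub>C blinfun_apply (W \<beta>) p) has_sum blinfun_apply T p) UNIV"
proof -
  have basis: "((\<lambda>\<beta>. c \<beta> *\<^sub>C blinfun_apply (W \<beta>) (basis_vec \<gamma>)) has_sum blinfun_apply T (basis_vec \<gamma>)) UNIV" for \<gamma>
  proof -
    let ?t = "blinfun_apply T (basis_vec \<gamma>)"
    have "((\<lambda>\<alpha>. coord ?t \<alpha> *\<^sub>C basis_vec \<alpha>) has_sum ?t) UNIV \<longleftrightarrow>
        ((\<lambda>\<alpha>. coord ?t \<alpha> *\<^sub>C basis_vec \<alpha>) has_sum ?t) (range (\<lambda>\<beta>. \<beta> @ \<gamma>))"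
      by (rule has_sum_cong_neutral) (use c in \<open>auto simp: has_symbol_def\<close>)
    then have "((\<lambda>\<alpha>. coord ?t \<alpha> *\<^sub>C basis_vec \<alpha>) has_sum ?t) (range (\<lambda>\<beta>. \<beta> @ \<gamma>))"
      using ell2_expansion by blast
    then have "((\<lambda>\<beta>. coord ?t (\<beta> @ \<gamma>) *\<^sub>C basis_vec (\<beta> @ \<gamma>)) has_sum ?t) UNIV"
      by (simp add: has_sum_reindex[OF inj_append_right] o_def)
    then show ?thesis using c by (simp add: has_symbol_def W_basis)
  qed
  obtain F a where F: "finite F" and p: "p = (\<Sum>\<gamma>\<in>F. a \<gamma> *\<^sub>C basis_vec \<gamma>)"
    using p by (auto simp: fock_polynomials_def)
  have "((\<lambda>\<beta>. \<Sum>\<gamma>\<in>F. a \<gamma> *\<^sub>C c \<beta> *\<^sub>C blinfun_apply (W \<beta>) (basis_vec \<gamma>)) has_sum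
      (\<Sum>\<gamma>\<in>F. a \<gamma> *\<^sub>C blinfun_apply T (basis_vec \<gamma>))) UNIV"
    by (intro has_sum_sum F has_sum_bounded_linear[OF bounded_linear_cscale] basis)
  moreover have "c \<beta> *\<^sub>C blinfun_apply (W \<beta>) p = (\<Sum>\<gamma>\<in>F. a \<gamma> *\<^sub>C c \<beta> *\<^sub>C blinfun_apply (W \<beta>) (basis_vec \<gamma>))" for \<beta>
    unfolding p apply_finite_sum[OF W_bounded] linear_sum[OF bounded_linear.linear[OF bounded_linear_cscale]]
    by (simp add: mult.commute)
  ultimately show ?thesis by (simp add: p apply_finite_sum[OF T])
qed

text \<open>For a bounded \<open>T\<close> with symbol \<open>c\<close>, the square sums in the
  definition are those of the columns of \<open>T\<close>, and the supremum over polynomials is at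
  most \<open>norm T\<close>.\<close>

lemma hardy_algebra_iff: "T \<in> hardy_algebra b \<longleftrightarrow> T \<in> bounded_ops \<and> (\<exists>c. has_symbol b T c)"
proof
  assume "T \<in> hardy_algebra b"
  then obtain c where T: "T \<in> bounded_ops" and
    c: "\<And>p. p \<in> fock_polynomials \<Longrightarrow> ((\<lambda>\<beta>. c \<beta> *\<^sub>C blinfun_apply (W \<beta>) p) has_sum blinfun_apply T p) UNIV"
    unfolding hardy_algebra_def by blast
  have "basis_vec \<gamma> \<in> fock_polynomials" for \<gamma> :: "'n list"
    unfolding fock_polynomials_def by (intro CollectI exI[of _ "{\<gamma>}"] exI[of _ "\<lambda>_. 1"]) simp
  then have "has_symbol b T c" by (intro has_symbolI_series c)
  with T show "T \<in> bounded_ops \<and> (\<exists>c. has_symbol b T c)" by blast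
next
  assume "T \<in> bounded_ops \<and> (\<exists>c. has_symbol b T c)"
  then obtain c where T: "T \<in> bounded_ops" and c: "has_symbol b T c" by blast
  note series = has_symbol_series[OF T c]
  have "(\<lambda>\<beta>. (cmod (c \<beta>))\<^sup>2 * (b \<gamma> / b (\<beta> @ \<gamma>))) summable_on UNIV" for \<gamma>
  proof -
    have "(\<lambda>\<alpha>. (cmod (coord (blinfun_apply T (basis_vec \<gamma>)) \<alpha>))\<^sup>2) summable_on range (\<lambda>\<beta>. \<beta> @ \<gamma>)"
      by (rule summable_on_subset_banach[OF coord_summable]) simp
    then have "(\<lambda>\<beta>. (cmod (coord (blinfun_apply T (basis_vec \<gamma>)) (\<beta> @ \<gamma>)))\<^sup>2) summable_on UNIV"
      by (simp add: summable_on_reindex[OF inj_append_right] o_def)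
    moreover have "(word_weight b \<beta> \<gamma>)\<^sup>2 = b \<gamma> / b (\<beta> @ \<gamma>)" for \<beta>
      using pos[of \<gamma>] pos[of "\<beta> @ \<gamma>"] by (simp add: word_weight_def)
    ultimately show ?thesis using c by (simp add: has_symbol_def norm_mult power_mult_distrib)
  qed
  moreover have "bdd_above ((\<lambda>p. norm (\<Sum>\<^sub>\<infinity>\<beta>. c \<beta> *\<^sub>C blinfun_apply (W \<beta>) p)) ` {p \<in> fock_polynomials. norm p \<le> 1})"
  proof (rule bdd_aboveI2)
    fix p :: "'n list ell2" assume p: "p \<in> {p \<in> fock_polynomials. norm p \<le> 1}"
    then have "norm (blinfun_apply T p) \<le> norm T * 1"
      by (intro order_trans[OF norm_blinfun] mult_left_mono) auto
    with p show "norm (\<Sum>\<^sub>\<infinity>\<beta>. c \<beta> *\<^sub>C blinfun_apply (W \<beta>) p) \<le> norm T"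
      by (simp add: infsumI[OF series])
  qed
  ultimately show "T \<in> hardy_algebra b"
    unfolding hardy_algebra_def using T series by blast
qed

section \<open>Polynomials in the creation operators, and closedness of the Hardy algebra\<close>

lemma op_polynomial_bounded: "(\<Sum>\<beta>\<in>F. op_scale (a \<beta>) (W \<beta>)) \<in> bounded_ops"
  unfolding bounded_ops_def
  by (auto intro!: ell2_eqI
      simp: blinfun.sum_left bounded_opsD[OF W_bounded] sum_distrib_left mult_ac)

lemma has_symbol_polynomial:
  assumes F: "finite F"
  shows "has_symbol b (\<Sum>\<beta>\<in>F. op_scale (a \<beta>) (W \<beta>)) (\<lambda>\<beta>. if \<beta> \<in> F then a \<beta> else 0)"
    (is "has_symbol b ?T _")
proof -
  have co: "coord (blinfun_apply ?T (basis_vec \<gamma>)) \<alpha> =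
      (\<Sum>\<delta>\<in>F. if \<alpha> = \<delta> @ \<gamma> then a \<delta> * of_real (word_weight b \<delta> \<gamma>) else 0)" for \<alpha> \<gamma>
    unfolding blinfun.sum_left coord_sum
    by (rule sum.cong) (simp_all add: W_basis)
  show ?thesis
    unfolding has_symbol_def co
  proof (intro conjI allI impI)
    fix \<beta> \<gamma>
    have "(\<Sum>\<delta>\<in>F. if \<beta> @ \<gamma> = \<delta> @ \<gamma> then a \<delta> * of_real (word_weight b \<delta> \<gamma>) else 0)
        = (\<Sum>\<delta>\<in>F. if \<beta> = \<delta> then a \<delta> * complex_of_real (word_weight b \<delta> \<gamma>) else 0)"
      by simp
    then show "(\<Sum>\<delta>\<in>F. if \<beta> @ \<gamma> = \<delta> @ \<gamma> then a \<delta> * of_real (word_weight b \<delta> \<gamma>) else 0)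
        = (if \<beta> \<in> F then a \<beta> else 0) * complex_of_real (word_weight b \<beta> \<gamma>)"
      using F by simp
  next
    fix \<gamma> \<alpha> :: "'n list" assume "\<alpha> \<notin> range (\<lambda>\<beta>. \<beta> @ \<gamma>)"
    then show "(\<Sum>\<delta>\<in>F. if \<alpha> = \<delta> @ \<gamma> then a \<delta> * of_real (word_weight b \<delta> \<gamma>) else 0) = (0 :: complex)"
      by (intro sum.neutral) auto
  qed
qed

lemma closedin_hardy_algebra:
  assumes "coordinate_topology \<tau>"
  shows "closedin \<tau> (hardy_algebra b)"
proof -
  interpret coordinate_topology \<tau> by fact
  let ?m = "\<lambda>\<gamma> \<alpha> (T :: 'n list ell2_op). coord (blinfun_apply T (basis_vec \<gamma>)) \<alpha>"
  \<comment> \<open>Column \<open>[]\<close> forces \<open>c \<beta>\<close> to be its entry at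
    \<open>\<beta>\<close> divided by \<open>word_weight b \<beta> []\<close>. Substituting this
    into column \<open>\<gamma>\<close> and cross-multiplying leaves a condition linear in
    \<open>T\<close>.\<close>
  let ?p = "\<lambda>(\<beta>, \<gamma>) T. ?m \<gamma> (\<beta> @ \<gamma>) T * of_real (word_weight b \<beta> []) - ?m [] \<beta> T * of_real (word_weight b \<beta> \<gamma>)"
  \<comment> \<open>For \<open>\<alpha>\<close> ending in \<open>\<gamma>\<close> the constant 0
    imposes no condition, so the intersection may run over all pairs.\<close>
  let ?q = "\<lambda>(\<gamma>, \<alpha>) T. if \<alpha> \<in> range (\<lambda>\<beta>. \<beta> @ \<gamma>) then 0 else ?m \<gamma> \<alpha> T"
  let ?Z = "\<lambda>f. {T \<in> topspace \<tau>. f T = (0::complex)}"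
  have closed: "closedin \<tau> (?Z f)" if "continuous_map \<tau> euclidean f" for f
    using closedin_continuous_map_preimage[OF that, of "{0}"] by simp
  have mult: "continuous_map \<tau> euclidean (\<lambda>T. f T * z)" if "continuous_map \<tau> euclidean f" for f and z :: complex
  proof -
    have "continuous_on UNIV (\<lambda>y. y * z)" by (intro continuous_intros)
    then show ?thesis using continuous_map_compose[OF that, of euclidean "\<lambda>y. y * z"] by (simp add: o_def)
  qed
  have "continuous_map \<tau> euclidean (?p x)" for x
    by (cases x) (auto intro!: continuous_map_diff mult continuous_coord)
  moreover have "continuous_map \<tau> euclidean (?q x)" for x
    by (cases x) (auto intro: continuous_coord)
  ultimately have "closedin \<tau> ((\<Inter>x. ?Z (?p x)) \<inter> (\<Inter>x. ?Z (?q x)))"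
    by (intro closedin_Int closedin_INT closed) auto
  moreover have "hardy_algebra b = (\<Inter>x. ?Z (?p x)) \<inter> (\<Inter>x. ?Z (?q x))" (is "_ = ?R")
  proof (intro set_eqI iffI)
    fix T assume "T \<in> hardy_algebra b"
    then obtain c where T: "T \<in> bounded_ops" and c: "has_symbol b T c" by (auto simp: hardy_algebra_iff)
    have "?m [] \<beta> T = c \<beta> * of_real (word_weight b \<beta> [])" for \<beta>
      using c[unfolded has_symbol_def, THEN conjunct1, rule_format, of "[]" \<beta>] by simp
    with T c show "T \<in> ?R" by (auto simp: topspace_eq has_symbol_def mult_ac)
  next
    fix T assume T: "T \<in> ?R"
    have "has_symbol b T (\<lambda>\<beta>. ?m [] \<beta> T / of_real (word_weight b \<beta> []))"
      unfolding has_symbol_def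
    proof (intro conjI allI impI)
      fix \<beta> \<gamma>
      have "?p (\<beta>, \<gamma>) T = 0" using T by blast
      then show "?m \<gamma> (\<beta> @ \<gamma>) T = ?m [] \<beta> T / of_real (word_weight b \<beta> []) * of_real (word_weight b \<beta> \<gamma>)"
        using word_weight_pos[of \<beta> "[]"] by (simp add: field_simps)
    next
      fix \<gamma> \<alpha> :: "'n list" assume "\<alpha> \<notin> range (\<lambda>\<beta>. \<beta> @ \<gamma>)"
      moreover have "?q (\<gamma>, \<alpha>) T = 0" using T by blast
      ultimately show "?m \<gamma> \<alpha> T = 0" by simp
    qed
    with T show "T \<in> hardy_algebra b" by (auto simp: hardy_algebra_iff topspace_eq)
  qed
  ultimately show ?thesis by simp
qed

subsection \<open>Cesaro means\<close>

definition cesaro_mean :: "('n list \<Rightarrow> complex) \<Rightarrow> nat \<Rightarrow> 'n list ell2_op" where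
  "cesaro_mean c N = (\<Sum>\<beta> | length \<beta> < N. op_scale (of_real (1 - length \<beta> / N) * c \<beta>) (W \<beta>))"

lemma finite_short_words: "finite {\<beta> :: 'n list. length \<beta> < N}"
proof -
  have "{\<beta> :: 'n list. length \<beta> < N} = (\<Union>k<N. {\<beta>. length \<beta> = k})" by auto
  then show ?thesis by simp
qed

lemma cesaro_mean_polynomial: "cesaro_mean c N \<in> op_polynomials (weighted_creation b)"
  unfolding op_polynomials_def cesaro_mean_def
  by (rule CollectI, intro exI conjI, rule refl, rule finite_short_words)

lemma cesaro_mean_bounded: "cesaro_mean c N \<in> bounded_ops"
  unfolding cesaro_mean_def by (rule op_polynomial_bounded)

lemma coord_cesaro_mean:
  assumes "has_symbol b T c"
  shows "coord (blinfun_apply (cesaro_mean c N) (basis_vec \<gamma>)) (\<beta> @ \<gamma>) =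
      (if length \<beta> < N then of_real (1 - length \<beta> / N) else 0) * coord (blinfun_apply T (basis_vec \<gamma>)) (\<beta> @ \<gamma>)"
    and "\<alpha> \<notin> range (\<lambda>\<beta>. \<beta> @ \<gamma>) \<Longrightarrow> coord (blinfun_apply (cesaro_mean c N) (basis_vec \<gamma>)) \<alpha> = 0"
  using has_symbol_polynomial[OF finite_short_words, of "\<lambda>\<beta>. of_real (1 - length \<beta> / N) * c \<beta>" N] assms
  unfolding cesaro_mean_def[symmetric] has_symbol_def by (simp_all add: mult.assoc)

lemma norm_cesaro_mean_le:
  assumes T: "T \<in> bounded_ops" and c: "has_symbol b T c" and N: "N > 0"
  shows "norm (cesaro_mean c N) \<le> norm T"
proof (rule norm_window_average_le[where len = length and N = N])
  fix \<alpha> \<gamma> :: "'n list"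
  show "of_nat N * coord (blinfun_apply (cesaro_mean c N) (basis_vec \<gamma>)) \<alpha> =
      of_nat (card ({length \<alpha>..<length \<alpha> + N} \<inter> {length \<gamma>..<length \<gamma> + N})) * coord (blinfun_apply T (basis_vec \<gamma>)) \<alpha>"
  proof (cases "\<alpha> \<in> range (\<lambda>\<beta>. \<beta> @ \<gamma>)")
    case True
    then obtain \<beta> where \<alpha>: "\<alpha> = \<beta> @ \<gamma>" by blast
    \<comment> \<open>Since \<open>\<alpha>\<close> is the longer word, the overlap starts at its
      length. For \<open>length \<beta> \<ge> N\<close> it is empty, in accordance with the
      truncated difference \<open>N - length \<beta>\<close>.\<close>
    have "{length \<alpha>..<length \<alpha> + N} \<inter> {length \<gamma>..<length \<gamma> + N} = {length \<alpha>..<length \<gamma> + N}"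
      by (auto simp: \<alpha>)
    then have "card ({length \<alpha>..<length \<alpha> + N} \<inter> {length \<gamma>..<length \<gamma> + N}) = N - length \<beta>"
      by (simp add: \<alpha>)
    moreover have "of_nat N * (if length \<beta> < N then of_real (1 - length \<beta> / N) else 0) = complex_of_nat (N - length \<beta>)"
      using N by (auto simp: of_nat_diff field_simps)
    ultimately show ?thesis
      unfolding \<alpha> coord_cesaro_mean(1)[OF c] by (simp only: mult.assoc[symmetric])
  next
    case False
    with c show ?thesis by (simp add: coord_cesaro_mean(2)[OF c] has_symbol_def)
  qed
qed (use T N cesaro_mean_bounded in auto)

text \<open>The norm bound reduces the claim to basis vectors. There the error is a coordinatewise
  multiple of the column of \<open>T\<close>, with factors of modulus at most 1 that tend to 0. The
  index \<open>Suc n\<close> keeps the denominator positive.\<close>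

lemma cesaro_mean_tendsto:
  assumes T: "T \<in> bounded_ops" and c: "has_symbol b T c"
  shows "(\<lambda>n. blinfun_apply (cesaro_mean c (Suc n)) x) \<longlonglongrightarrow> blinfun_apply T x"
proof -
  let ?D = "\<lambda>n. cesaro_mean c (Suc n) - T"
  let ?t = "\<lambda>\<gamma>. coord (blinfun_apply T (basis_vec \<gamma>))"
  \<comment> \<open>The minimum merges two cases: words kept by the mean have error factor
    \<open>length \<beta> / Suc n\<close>, and words cut off have error factor 1.\<close>
  have in_range: "coord (blinfun_apply (?D n) (basis_vec \<gamma>)) (\<beta> @ \<gamma>) = - of_real (min 1 (length \<beta> / Suc n)) * ?t \<gamma> (\<beta> @ \<gamma>)"
    for n \<beta> \<gamma>
  proof -
    have "(if length \<beta> < Suc n then complex_of_real (1 - length \<beta> / Suc n) else 0) - 1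
        = - of_real (min 1 (length \<beta> / Suc n))"
      by (auto simp: min_def simp del: of_nat_Suc)
    then show ?thesis
      unfolding blinfun.diff_left coord_simps coord_cesaro_mean(1)[OF c]
      by (metis left_diff_distrib mult_1)
  qed
  have off_range: "coord (blinfun_apply (?D n) (basis_vec \<gamma>)) \<alpha> = 0" if "\<alpha> \<notin> range (\<lambda>\<beta>. \<beta> @ \<gamma>)" for n \<alpha> \<gamma>
    using that c by (simp add: blinfun.diff_left coord_cesaro_mean(2)[OF c] has_symbol_def)
  have "(\<lambda>n. blinfun_apply (?D n) (basis_vec \<gamma>)) \<longlonglongrightarrow> 0" for \<gamma>
  proof (rule tendsto_zero_dominated_coord)
    show "cmod (coord (blinfun_apply (?D n) (basis_vec \<gamma>)) \<alpha>) \<le> cmod (?t \<gamma> \<alpha>)" for n \<alpha>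
    proof (cases "\<alpha> \<in> range (\<lambda>\<beta>. \<beta> @ \<gamma>)")
      case True
      then show ?thesis by (auto simp: in_range norm_mult intro!: mult_left_le_one_le simp del: of_nat_Suc)
    qed (simp add: off_range)
    show "(\<lambda>n. coord (blinfun_apply (?D n) (basis_vec \<gamma>)) \<alpha>) \<longlonglongrightarrow> 0" for \<alpha>
    proof (cases "\<alpha> \<in> range (\<lambda>\<beta>. \<beta> @ \<gamma>)")
      case True
      then obtain \<beta> where \<alpha>: "\<alpha> = \<beta> @ \<gamma>" by blast
      have "(\<lambda>n. (length \<beta> * cmod (?t \<gamma> \<alpha>)) * inverse (real (Suc n))) \<longlonglongrightarrow> 0"
        by (intro tendsto_mult_right_zero LIMSEQ_inverse_real_of_nat)
      then show ?thesis
      proof (rule Lim_null_comparison[rotated], intro always_eventually allI)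
        fix n
        have "min 1 (length \<beta> / Suc n) * cmod (?t \<gamma> \<alpha>) \<le> (length \<beta> / Suc n) * cmod (?t \<gamma> \<alpha>)"
          by (intro mult_right_mono) auto
        then show "norm (coord (blinfun_apply (?D n) (basis_vec \<gamma>)) \<alpha>) \<le> (length \<beta> * cmod (?t \<gamma> \<alpha>)) * inverse (real (Suc n))"
          unfolding \<alpha> in_range by (simp add: norm_mult divide_inverse mult_ac del: of_nat_Suc)
      qed
    qed (simp add: off_range)
  qed
  moreover have "norm (?D n) \<le> 2 * norm T" for n
    using norm_triangle_ineq4[of "cesaro_mean c (Suc n)" T] norm_cesaro_mean_le[OF T c, of "Suc n"] by simp
  ultimately have "(\<lambda>n. blinfun_apply (?D n) x) \<longlonglongrightarrow> 0"
    by (rule strong_limit_from_basis[OF bounded_ops_diff[OF cesaro_mean_bounded T], rotated])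
  then show ?thesis by (simp add: blinfun.diff_left LIM_zero_iff)
qed

section \<open>Closures and sequential closures of the polynomials\<close>

lemma hardy_algebra_closures:
  assumes "coordinate_topology \<tau>"
  shows "hardy_algebra b = \<tau> closure_of (op_polynomials (weighted_creation b))"
    and "hardy_algebra b = seq_closure \<tau> (op_polynomials (weighted_creation b))"
proof -
  interpret coordinate_topology \<tau> by fact
  let ?P = "op_polynomials (weighted_creation b)"
  note closed = closedin_hardy_algebra[OF assms]
  have P: "?P \<subseteq> hardy_algebra b"
  proof
    fix T assume "T \<in> ?P"
    then obtain F a where F: "finite F" and T: "T = (\<Sum>\<beta>\<in>F. op_scale (a \<beta>) (W \<beta>))"
      unfolding op_polynomials_def by blast
    show "T \<in> hardy_algebra b"
      unfolding hardy_algebra_iff T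
      by (rule conjI[OF op_polynomial_bounded exI[of _ "\<lambda>\<beta>. if \<beta> \<in> F then a \<beta> else 0"]])
        (rule has_symbol_polynomial[OF F])
  qed
  have seq: "hardy_algebra b \<subseteq> seq_closure \<tau> ?P"
  proof
    fix T assume "T \<in> hardy_algebra b"
    then obtain c where T: "T \<in> bounded_ops" and c: "has_symbol b T c" by (auto simp: hardy_algebra_iff)
    have "limitin \<tau> (\<lambda>n. cesaro_mean c (Suc n)) T sequentially"
      by (rule limitin_bounded[OF cesaro_mean_bounded T norm_cesaro_mean_le[OF T c zero_less_Suc]
            cesaro_mean_tendsto[OF T c]])
    then show "T \<in> seq_closure \<tau> ?P"
      unfolding seq_closure_def using cesaro_mean_polynomial
      by (intro CollectI exI[of _ "\<lambda>n. cesaro_mean c (Suc n)"]) auto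
  qed
  \<comment> \<open>Applied twice: with \<open>S\<close> the closure of \<open>?P\<close>, placing
    the Hardy algebra inside that closure, and with \<open>S\<close> the Hardy algebra itself,
    bounding the sequential closure from above.\<close>
  have limit: "seq_closure \<tau> ?P \<subseteq> S" if "closedin \<tau> S" "?P \<subseteq> S" for S
  proof
    fix T assume "T \<in> seq_closure \<tau> ?P"
    then obtain s where "range s \<subseteq> ?P" and lim: "limitin \<tau> s T sequentially"
      unfolding seq_closure_def by blast
    with that have "\<forall>\<^sub>F n in sequentially. s n \<in> S" by (intro always_eventually) auto
    with lim that show "T \<in> S" by (intro limitin_closedin) auto
  qed
  \<comment> \<open>\<open>closure_of\<close> meets its argument with the topological space, so this
    uses that \<open>?P\<close> lies in the closed set \<open>hardy_algebra b\<close> and hence in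
    the space.\<close>
  have "?P \<subseteq> \<tau> closure_of ?P"
    using P closed by (intro closure_of_subset) (auto dest: closedin_subset)
  from order_trans[OF seq limit[OF closedin_closure_of this]] closure_of_minimal[OF P closed]
  show "hardy_algebra b = \<tau> closure_of ?P" by (rule equalityI)
  from seq limit[OF closed P] show "hardy_algebra b = seq_closure \<tau> ?P" by (rule equalityI)
qed

end

theorem theorem2p5:
  fixes b :: "'n::finite list \<Rightarrow> real"
  assumes "b [] = 1"
    and "\<And>\<alpha>. length \<alpha> \<ge> 1 \<Longrightarrow> b \<alpha> > 0"
    and "free_holomorphic_near_0 (\<lambda>\<alpha>. complex_of_real (b \<alpha>))"
    and "\<And>i. bdd_above (range (\<lambda>\<alpha>. b \<alpha> / b (i # \<alpha>)))"
    and "\<And>i. bdd_above (range (\<lambda>\<alpha>. b \<alpha> / b (\<alpha> @ [i])))"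
  shows "hardy_algebra b = SOT closure_of (op_polynomials (weighted_creation b))
    \<and> hardy_algebra b = WOT closure_of (op_polynomials (weighted_creation b))
    \<and> hardy_algebra b = weak_star_topology closure_of (op_polynomials (weighted_creation b))
    \<and> hardy_algebra b = seq_closure SOT (op_polynomials (weighted_creation b))
    \<and> hardy_algebra b = seq_closure WOT (op_polynomials (weighted_creation b))
    \<and> hardy_algebra b = seq_closure weak_star_topology (op_polynomials (weighted_creation b))"
proof -
  interpret fock_weight b
  proof
    show "b \<alpha> > 0" for \<alpha> using assms(1,2) by (cases \<alpha>) auto
  qed (rule assms(4))
  show ?thesis
    by (intro conjI hardy_algebra_closures SOT_coordinate WOT_coordinate weak_star_coordinate)
qed

end
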